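(* Let $G$ be a finitely generated solvable group which is virtually torsion-free and not virtually abelian. Let $X$ be a faithful $G$-set such that the action of $G$ on $X$ has finitely many orbits. Then $\mathrm{vol}_{G,X}(n)\succcurlyeq n^2$.
   Context: Let $G$ be a finitely generated group, $S$ a finite symmetric generating set, and $|\cdot|_S$ the word length. A $G$-set is a non-empty set with a $G$-action; it is faithful if only the identity of $G$ acts trivially. The growth of the action of $G$ on a $G$-set $X$ is $\mathrm{vol}_{G,X}(n)=\max_{x\in X}|\{gx : g\in G,\ |g|_S\le n\}|$. For functions $f,g$ from $\mathbb{N}$ to the non-negative reals, $f(n)\preccurlyeq g(n)$ (equivalently $g(n)\succcurlyeq f(n)$) means that there is a constant $C>0$ such that $f(n)\le C g(Cn)$ for all sufficiently large $n$. Up to the equivalence relation associated with $\preccurlyeq$, $\mathrm{vol}_{G,X}$ does not depend on $S$. *)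

theory Defs
  imports Complex_Main "HOL-Algebra.Group_Action" "HOL-Algebra.Solvable_Groups"
begin

definition symmetric_generating_set :: "('a, 'b) monoid_scheme \<Rightarrow> 'a set \<Rightarrow> bool"
  where "symmetric_generating_set G S \<longleftrightarrow>
    S \<subseteq> carrier G \<and> (\<forall>s\<in>S. inv\<^bsub>G\<^esub> s \<in> S) \<and> generate G S = carrier G"

text \<open>For elements that are not products of elements of \<open>S\<close> the value is unspecified; this does
  not occur when \<open>S\<close> is a symmetric generating set (see \<open>ex_word\<close>).\<close>

definition word_length :: "('a, 'b) monoid_scheme \<Rightarrow> 'a set \<Rightarrow> 'a \<Rightarrow> nat"
  where "word_length G S g =
    (LEAST n. \<exists>ws. set ws \<subseteq> S \<and> length ws = n \<and> foldr (mult G) ws \<one>\<^bsub>G\<^esub> = g)"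

definition word_ball :: "('a, 'b) monoid_scheme \<Rightarrow> 'a set \<Rightarrow> nat \<Rightarrow> 'a set"
  where "word_ball G S n = {g \<in> carrier G. word_length G S g \<le> n}"

text \<open>The maximum is over a finite set of numbers when \<open>S\<close> is a finite symmetric generating set
  (see \<open>finite_action_growth_set\<close>).\<close>

definition action_growth ::
    "('a, 'b) monoid_scheme \<Rightarrow> 'a set \<Rightarrow> 'x set \<Rightarrow> ('a \<Rightarrow> 'x \<Rightarrow> 'x) \<Rightarrow> nat \<Rightarrow> nat"
  where "action_growth G S X \<phi> n = Max ((\<lambda>x. card ((\<lambda>g. \<phi> g x) ` word_ball G S n)) ` X)"

text \<open>The constant is a natural number, since the functions are only defined on the naturals.\<close>

definition growth_le :: "(nat \<Rightarrow> real) \<Rightarrow> (nat \<Rightarrow> real) \<Rightarrow> bool"  (infix \<open>\<preceq>\<close> 50)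
  where "f \<preceq> g \<longleftrightarrow> (\<exists>C::nat. C > 0 \<and> (\<forall>\<^sub>F n in sequentially. f n \<le> real C * g (C * n)))"

definition torsion_free :: "('a, 'b) monoid_scheme \<Rightarrow> bool"
  where "torsion_free G \<longleftrightarrow>
    (\<forall>x\<in>carrier G. \<forall>n::nat. n > 0 \<longrightarrow> x [^]\<^bsub>G\<^esub> n = \<one>\<^bsub>G\<^esub> \<longrightarrow> x = \<one>\<^bsub>G\<^esub>)"

definition virtually ::
    "(('a, 'b) monoid_scheme \<Rightarrow> bool) \<Rightarrow> ('a, 'b) monoid_scheme \<Rightarrow> bool"
  where "virtually P G \<longleftrightarrow>
    (\<exists>H. subgroup H G \<and> finite (rcosets\<^bsub>G\<^esub> H) \<and> P (G\<lparr>carrier := H\<rparr>))"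

lemma (in group) foldr_mult_append:
  assumes "set us \<subseteq> carrier G" "set vs \<subseteq> carrier G"
  shows "foldr (mult G) (us @ vs) \<one> = foldr (mult G) us \<one> \<otimes> foldr (mult G) vs \<one>"
proof -
  have closed: "foldr (mult G) ws \<one> \<in> carrier G" if "set ws \<subseteq> carrier G" for ws
    using that by (induction ws) auto
  show ?thesis
    using assms(1) by (induction us) (auto simp: m_assoc closed assms(2))
qed

lemma (in group) ex_word:
  assumes "symmetric_generating_set G S" "g \<in> carrier G"
  shows "\<exists>ws. set ws \<subseteq> S \<and> foldr (mult G) ws \<one> = g"
proof -
  have S: "S \<subseteq> carrier G" "\<And>s. s \<in> S \<Longrightarrow> inv s \<in> S" and "g \<in> generate G S"
    using assms by (auto simp: symmetric_generating_set_def)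
  from \<open>g \<in> generate G S\<close> show ?thesis
  proof induction
    case one
    show ?case by (rule exI[of _ "[]"]) simp
  next
    case (incl h)
    then show ?case using S by (intro exI[of _ "[h]"]) auto
  next
    case (inv h)
    then show ?case using S by (intro exI[of _ "[inv h]"]) auto
  next
    case (eng g h)
    then obtain us vs where "set us \<subseteq> S" "foldr (mult G) us \<one> = g"
      "set vs \<subseteq> S" "foldr (mult G) vs \<one> = h" by blast
    then show ?case
      using S foldr_mult_append[of us vs] by (intro exI[of _ "us @ vs"]) auto
  qed
qed

lemma (in group) word_length_witness:
  assumes "symmetric_generating_set G S" "g \<in> carrier G"
  shows "\<exists>ws. set ws \<subseteq> S \<and> length ws = word_length G S g \<and> foldr (mult G) ws \<one> = g"
  unfolding word_length_def using ex_word[OF assms] by - (rule LeastI_ex, blast)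

lemma (in group) finite_word_ball:
  assumes "symmetric_generating_set G S" "finite S"
  shows "finite (word_ball G S n)"
proof (rule finite_subset)
  show "word_ball G S n \<subseteq> (\<lambda>ws. foldr (mult G) ws \<one>) ` {ws. set ws \<subseteq> S \<and> length ws \<le> n}"
    using word_length_witness[OF assms(1)] by (fastforce simp: word_ball_def)
  show "finite ((\<lambda>ws. foldr (mult G) ws \<one>) ` {ws. set ws \<subseteq> S \<and> length ws \<le> n})"
    using assms(2) by (intro finite_imageI finite_lists_length_le)
qed

lemma (in group) finite_action_growth_set:
  assumes "symmetric_generating_set G S" "finite S"
  shows "finite ((\<lambda>x. card ((\<lambda>g. \<phi> g x) ` word_ball G S n)) ` X)"
proof (rule finite_subset)
  show "(\<lambda>x. card ((\<lambda>g. \<phi> g x) ` word_ball G S n)) ` X \<subseteq> {..card (word_ball G S n)}"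
    using finite_word_ball[OF assms] by (auto intro: card_image_le)
qed simp

end

(* Suppose the growth is not bounded below by a quadratic function. It suffices to find, for each
   orbit G/H, a subgroup N of finite index such that every element of [N, N] has a power acting
   trivially on G/H: there are finitely many orbits, so the intersection of these subgroups with a
   torsion-free subgroup of finite index is abelian.

   If K is normal in G and has infinitely many orbits on G/H, then the orbits of each a in K are
   bounded: a long orbit segment of a, moved to linearly many distinct K-orbits, would give quadratic
   growth. So it is enough that [N, N] is contained in a subgroup H' >= H of infinite index. This is
   proved by induction on the derived length d of the action. Let A be the last nontrivial derived
   subgroup. If AH has infinite index, pass to the action on G/AH. Otherwise AH is finitely generated
   and acts on the abelian group A/(A Int H) by affine maps; the linear part has derived length
   d - 1 and inherits subquadratic growth. If it has an infinite orbit, then by induction some h in H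
   has an infinite orbit on A/(A Int H), say of a, and a and h generate too many points: this is a
   statement on the Z[x]-module generated by a. Otherwise the linear part is virtually trivial, and
   a subgroup of finite index acts by translations, hence through an abelian group. *)

theory Submission
  imports "HOL-Computational_Algebra.Polynomial" Defs
begin

text \<open>An infinite orbit of the linear part yields a single element with an infinite orbit
  because of the shape of the induction claim. If [\<Lambda>, \<Lambda>] lies in a subgroup H' of
  infinite index that contains the stabilizer, then \<Lambda>/(\<Lambda> Int H') is abelian,
  infinite and finitely generated, so some element has no power in H'. This is why finite generation
  must be carried along to subgroups of finite index.

  What a and h generate is measured in Z[x]/I, where no positive power of x fixes 1. No single
  family of points works for all these modules. Modulo (x - 1)^2 the subset sums of the x^i collide,
  but the points (k q + 1) x^(m i) are distinct and give a grid of quadratic size. Over Z/d the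
  multiples of 1 are finite in number, but the subset sums grow exponentially. If both families
  always collided, some x^m would behave like a rational number l/k; the summand 1 in the grid
  coefficients makes a second collision contradict unique factorization.\<close>

section \<open>Modules over the integer polynomials with aperiodic generator\<close>

text \<open>\<open>I\<close> will be the kernel of the map from \<int>[x] to A/(A Int H) that sends
  1 to a. There x acts as conjugation by h, which is injective; this is \<open>cancel_X\<close>.
  That no positive power of h fixes the class of a is \<open>aperiodic\<close>.\<close>

locale aperiodic_ideal =
  fixes I :: "int poly set"
  assumes zero_mem: "0 \<in> I"
    and add_mem: "p \<in> I \<Longrightarrow> q \<in> I \<Longrightarrow> p + q \<in> I"
    and mult_mem: "p \<in> I \<Longrightarrow> r * p \<in> I"
    and cancel_X: "[:0, 1:] * p \<in> I \<Longrightarrow> p \<in> I"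
    and aperiodic: "e > 0 \<Longrightarrow> [:0, 1:] ^ e - 1 \<notin> I"
begin

abbreviation X :: "int poly" where "X \<equiv> [:0, 1:]"

lemma diff_mem: "p \<in> I \<Longrightarrow> q \<in> I \<Longrightarrow> p - q \<in> I"
  using add_mem[of p "(-1) * q"] mult_mem[of q "-1"] by simp

lemma diff_mem_swap: "p - q \<in> I \<Longrightarrow> q - p \<in> I"
  using mult_mem[of "p - q" "-1"] by simp

lemma cancel_X_power: "X ^ n * p \<in> I \<Longrightarrow> p \<in> I"
proof (induction n)
  case (Suc n)
  then show ?case using cancel_X[of "X ^ n * p"] by (simp only: power_Suc mult.assoc)
qed simp

text \<open>The first property gives exponentially many, the second quadratically many classes modulo \<open>I\<close>
  that are reached from \<open>0\<close> by linearly many operations from a finite set of affine maps.\<close>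

definition subset_sum_free :: "int poly \<Rightarrow> bool" where
  "subset_sum_free w \<longleftrightarrow> (\<forall>J J'. finite J \<longrightarrow> finite J' \<longrightarrow>
     (\<Sum>i\<in>J. X ^ i * w) - (\<Sum>i\<in>J'. X ^ i * w) \<in> I \<longrightarrow> J = J')"

definition grid_free :: "nat \<Rightarrow> nat \<Rightarrow> bool" where
  "grid_free m k \<longleftrightarrow> (\<forall>i q i' q'.
     of_nat (k * q + 1) * X ^ (m * i) - of_nat (k * q' + 1) * X ^ (m * i') \<in> I \<longrightarrow> i = i' \<and> q = q')"

text \<open>The module generated by \<open>w\<close> modulo \<open>I\<close> is finite: division by
  the monic \<open>q\<close> bounds the degree of a representative, and the torsion \<open>d\<close>
  bounds its coefficients.\<close>

lemma ex_finite_reps: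
  assumes "lead_coeff q = 1" "q * w \<in> I" "d > 0" "of_nat d * w \<in> I"
  shows "\<exists>R. finite R \<and> (\<forall>f. \<exists>r\<in>R. (f - r) * w \<in> I)"
proof (intro exI conjI allI)
  let ?L = "{xs. set xs \<subseteq> {0..<int d} \<and> length xs \<le> degree q}"
  show "finite (Poly ` ?L)"
    by (intro finite_imageI finite_lists_length_le) simp
  fix f
  have q0: "q \<noteq> 0" using assms(1) by auto
  obtain s r where sr: "pseudo_divmod f q = (s, r)" by fastforce
  have f: "f = q * s + r" and r: "r = 0 \<or> degree r < degree q"
    using pseudo_divmod[OF q0 sr] assms(1) by simp_all
  define r' where "r' = Poly (map (\<lambda>c. c mod int d) (coeffs r))"
  have "length (coeffs r) \<le> degree q"
    using r by (cases "r = 0") (auto simp: length_coeffs_degree)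
  then have "r' \<in> Poly ` ?L"
    using assms(3) unfolding r'_def by (intro imageI) auto
  moreover have "r - r' = of_nat d * Poly (map (\<lambda>c. c div int d) (coeffs r))"
  proof (rule poly_eqI)
    fix n
    have "coeff r n = coeff (Poly (coeffs r)) n" by simp
    then show "coeff (r - r') n = coeff (of_nat d * Poly (map (\<lambda>c. c div int d) (coeffs r))) n"
      unfolding r'_def
      by (auto simp: of_nat_poly nth_default_def minus_mod_eq_mult_div coeff_Poly_eq simp del: Poly_coeffs)
  qed
  then have "f - r' = q * s + of_nat d * Poly (map (\<lambda>c. c div int d) (coeffs r))"
    using f by (simp add: algebra_simps)
  then have "(f - r') * w = s * (q * w) + Poly (map (\<lambda>c. c div int d) (coeffs r)) * (of_nat d * w)"
    by (simp add: algebra_simps)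
  then have "(f - r') * w \<in> I"
    using add_mem mult_mem assms(2,4) by presburger
  ultimately show "\<exists>r\<in>Poly ` ?L. (f - r) * w \<in> I" by blast
qed

text \<open>A collision of subset sums is a relation with coefficients in {-1, 0, 1}, hence monic up
  to sign. Together with the torsion it makes the module generated by \<open>w\<close> finite, so
  two powers of X agree on \<open>w\<close>.\<close>

lemma torsion_periodic:
  assumes "\<not> subset_sum_free w" "d > 0" "of_nat d * w \<in> I"
  shows "\<exists>e>0. (X ^ e - 1) * w \<in> I"
proof -
  obtain J J' where J: "finite J" "finite J'" "J \<noteq> J'"
    "(\<Sum>i\<in>J. X ^ i * w) - (\<Sum>i\<in>J'. X ^ i * w) \<in> I"
    using assms(1) unfolding subset_sum_free_def by blast
  define q :: "int poly" where "q = (\<Sum>i\<in>J. X ^ i) - (\<Sum>i\<in>J'. X ^ i)"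
  have c: "coeff q n = of_bool (n \<in> J) - of_bool (n \<in> J')" for n
  proof -
    have "X ^ i = monom 1 i" for i by (simp add: monom_altdef)
    then show ?thesis using J(1,2) by (simp add: q_def coeff_sum)
  qed
  have "q \<noteq> 0"
  proof
    assume "q = 0"
    then have "n \<in> J \<longleftrightarrow> n \<in> J'" for n using c[of n] by (auto split: if_splits)
    then show False using J(3) by blast
  qed
  then have "lead_coeff q \<noteq> 0" by simp
  then have lc: "lead_coeff q * lead_coeff q = 1" using c[of "degree q"] by (auto split: if_splits)
  have qw: "q * w \<in> I" using J(4) by (simp add: q_def left_diff_distrib sum_distrib_right)
  define q' where "q' = smult (lead_coeff q) q"
  have "lead_coeff q' = 1" using lc \<open>q \<noteq> 0\<close> by (simp add: q'_def)
  moreover have "q' * w \<in> I" using mult_mem[OF qw, of "[:lead_coeff q:]"] by (simp add: q'_def)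
  ultimately obtain R where R: "finite R" "\<forall>f. \<exists>r\<in>R. (f - r) * w \<in> I"
    using ex_finite_reps[OF _ _ assms(2,3), of q'] by auto
  then obtain \<rho> where \<rho>: "\<And>f. \<rho> f \<in> R" "\<And>f. (f - \<rho> f) * w \<in> I" by metis
  have "\<not> inj (\<lambda>j. \<rho> (X ^ j))"
    using finite_subset[of "range (\<lambda>j. \<rho> (X ^ j))" R] R(1) \<rho>(1) finite_imageD infinite_UNIV_nat by blast
  then obtain i j where ij: "\<rho> (X ^ i) = \<rho> (X ^ j)" "i < j"
    by (metis (no_types, lifting) injI nat_neq_iff)
  have "(X ^ j - X ^ i) * w \<in> I"
    using diff_mem[OF \<rho>(2)[of "X ^ j"] \<rho>(2)[of "X ^ i"]] ij(1) by (simp add: algebra_simps)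
  moreover have "(X ^ j - X ^ i) * w = X ^ i * ((X ^ (j - i) - 1) * w)"
  proof -
    have "X ^ j = X ^ i * X ^ (j - i)" using ij(2) by (simp flip: power_add)
    then show ?thesis by (simp only: left_diff_distrib right_diff_distrib mult.assoc mult_1 mult_1_right)
  qed
  ultimately have "(X ^ (j - i) - 1) * w \<in> I" using cancel_X_power by metis
  then show ?thesis using ij(2) by (intro exI[of _ "j - i"]) simp
qed

lemma diff_power_mem:
  assumes "u - v \<in> I" shows "u ^ n - v ^ n \<in> I"
proof (induction n)
  case (Suc n)
  have "u ^ Suc n - v ^ Suc n = u * (u ^ n - v ^ n) + v ^ n * (u - v)" by (simp add: algebra_simps)
  then show ?case using Suc assms add_mem mult_mem by metis
qed (simp add: zero_mem)

text \<open>For y = X^(e m), both (y - 1)^2 and g (y - 1) lie in \<open>I\<close>. The first gives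
  y^n = 1 + n (y - 1) modulo \<open>I\<close>, and the second then gives y^g = 1, against
  \<open>aperiodic\<close>.\<close>

lemma no_torsion_periodic:
  assumes "g > 0" "of_nat g * (X ^ m - 1) \<in> I" "(X ^ e - 1) * (X ^ m - 1) \<in> I" "e > 0" "m > 0"
  shows False
proof -
  define y where "y = X ^ (e * m)"
  have *: "\<exists>s. u ^ n - 1 = s * (u - 1)" for n and u :: "int poly"
    by (metis dvdE mult.commute power_diff_1_eq)
  obtain s where s: "y - 1 = s * (X ^ e - 1)"
    using *[of "X ^ e" m] by (auto simp: y_def power_mult)
  obtain t where t: "y - 1 = t * (X ^ m - 1)"
    using *[of "X ^ m" e] unfolding y_def by (metis power_mult mult.commute)
  \<comment> \<open>y - 1 is divisible by X^e - 1 and by X^m - 1; one factor of the square is used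
    for each.\<close>
  have "(y - 1) * (y - 1) = s * t * ((X ^ e - 1) * (X ^ m - 1))"
    by (subst (1) s, subst t) (simp only: ac_simps)
  then have sq: "(y - 1) * (y - 1) \<in> I" using assms(3) mult_mem by metis
  have "of_nat g * (y - 1) = t * (of_nat g * (X ^ m - 1))"
    by (subst t) (simp only: ac_simps)
  then have gy: "of_nat g * (y - 1) \<in> I" using assms(2) mult_mem by metis
  have "y ^ n - 1 - of_nat n * (y - 1) \<in> I" for n
  proof (induction n)
    case (Suc n)
    have "y ^ Suc n - 1 - of_nat (Suc n) * (y - 1)
        = y * (y ^ n - 1 - of_nat n * (y - 1)) + of_nat n * ((y - 1) * (y - 1))"
      by (simp add: algebra_simps)
    then show ?case using Suc sq add_mem mult_mem by metis
  qed (simp add: zero_mem)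
  from add_mem[OF this[of g] gy] have "y ^ g - 1 \<in> I" by simp
  then show False using aperiodic[of "e * m * g"] assms(1,4,5) by (simp add: y_def power_mult)
qed

text \<open>A collision with i = i' would put a positive integer into \<open>I\<close>. So the two
  powers of X differ, and the smaller one can be cancelled.\<close>

lemma not_grid_free:
  assumes "\<not> grid_free m k" and char0: "\<And>n. n > 0 \<Longrightarrow> of_nat n \<notin> I" and "k > 0"
  obtains e a b where "e > 0" "of_nat (k * a + 1) * X ^ (m * e) - of_nat (k * b + 1) \<in> I"
proof -
  note goal = that
  have main: thesis
    if h: "of_nat (k * q + 1) * X ^ (m * i) - of_nat (k * q' + 1) * X ^ (m * i') \<in> I" "i' < i"
    for i i' q q'
  proof -
    have "m * i = m * i' + m * (i - i')" using h(2)
      by (metis add_diff_inverse_nat distrib_left less_imp_not_less)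
    then have "of_nat (k * q + 1) * X ^ (m * i) - of_nat (k * q' + 1) * X ^ (m * i')
        = X ^ (m * i') * (of_nat (k * q + 1) * X ^ (m * (i - i')) - of_nat (k * q' + 1))"
      by (simp only: power_add) (simp add: algebra_simps)
    with h show thesis using goal[of "i - i'"] cancel_X_power by (metis zero_less_diff)
  qed
  obtain i q i' q' where h:
    "of_nat (k * q + 1) * X ^ (m * i) - of_nat (k * q' + 1) * X ^ (m * i') \<in> I" "\<not> (i = i' \<and> q = q')"
    using assms(1) unfolding grid_free_def by blast
  show thesis
  proof (cases i i' rule: linorder_cases)
    case less
    then show thesis using main[OF diff_mem_swap[OF h(1)]] by blast
  next
    case greater
    then show thesis using main[OF h(1)] by blast
  next
    case equal
    have "False" if "of_nat (k * a + 1) * X ^ (m * i) - of_nat (k * b + 1) * X ^ (m * i) \<in> I" "b < a" for a b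
    proof -
      have "k * a + 1 = (k * b + 1) + k * (a - b)" using that(2)
        by (metis add.assoc add.commute add_diff_inverse_nat distrib_left less_imp_not_less)
      then have "of_nat (k * a + 1) * X ^ (m * i) - of_nat (k * b + 1) * X ^ (m * i)
        = X ^ (m * i) * of_nat (k * (a - b))"
        by (simp only: of_nat_add) (simp add: algebra_simps)
      then have "of_nat (k * (a - b)) \<in> I" using that(1) cancel_X_power by metis
      moreover have "k * (a - b) > 0" using that(2) assms(3) by simp
      ultimately show False using char0 by blast
    qed
    then show thesis using h diff_mem_swap[OF h(1)] equal by (metis nat_neq_iff)
  qed
qed

text \<open>If both fail, a collision in the grid (1, 1) gives k X^m = l, and one in the grid (m,
  \<kappa>) gives j X^(m e) = j' with j and j' congruent to 1 modulo \<kappa>. Comparison with the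
  e-th power of the first relation yields l^e j = k^e j' modulo \<open>I\<close>, hence in the
  integers. After division by the gcd, k' divides j and l' divides j', which is absurd when \<kappa>
  is one of k', l' and exceeds 1. If k' = l' = 1, then X^m - 1 is a torsion element, and it is
  periodic.\<close>

lemma subset_sum_free_or_grid_free: "(\<exists>w. subset_sum_free w) \<or> (\<exists>m k. grid_free m k)"
proof (rule ccontr)
  assume "\<not> ?thesis"
  then have nT: "\<And>w. \<not> subset_sum_free w" and nN: "\<And>m k. \<not> grid_free m k" by auto
  \<comment> \<open>A positive integer in \<open>I\<close> would make 1 a torsion element, hence
    periodic, against \<open>aperiodic\<close>.\<close>
  have char0: "of_nat n \<notin> I" if "n > 0" for n
    using torsion_periodic[OF nT, of n 1] aperiodic that by auto
  have char0': "a = b" if "of_nat a - of_nat b \<in> I" for a b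
  proof (rule ccontr)
    assume "a \<noteq> b"
    then consider "a < b" | "b < a" by linarith
    then show False
    proof cases
      case 1
      then have "of_nat b - of_nat a = (of_nat (b - a) :: int poly)" by (simp add: of_nat_diff)
      then show False using char0[of "b - a"] 1 diff_mem_swap[OF that] by simp
    next
      case 2
      then have "of_nat a - of_nat b = (of_nat (a - b) :: int poly)" by (simp add: of_nat_diff)
      then show False using char0[of "a - b"] 2 that by simp
    qed
  qed
  obtain m k0 l0 where "m > 0" and kl0: "of_nat (1 * k0 + 1) * X ^ (1 * m) - of_nat (1 * l0 + 1) \<in> I"
    using not_grid_free[OF nN char0, of 1 1] by auto
  define k l where "k = k0 + 1" and "l = l0 + 1"
  have kl: "of_nat k * X ^ m - of_nat l \<in> I" and pos: "k > 0" "l > 0"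
    using kl0 by (simp_all only: k_def l_def mult_1)
  define g where "g = gcd k l"
  obtain k' l' where k': "k = g * k'" "l = g * l'" "coprime k' l'"
    using pos unfolding g_def by (metis gcd_coprime_exists mult.commute gcd_pos_nat less_numeral_extra(3))
  have "g > 0" using pos by (simp add: g_def)
  have "k' > 0" "l' > 0" using k' pos by auto
  define \<kappa> where "\<kappa> = (if k' = 1 then l' else k')"
  show False
  proof (cases "\<kappa> = 1")
    case True
    then have "k = g" "l = g" using k' by (auto simp: \<kappa>_def split: if_splits)
    then have g: "of_nat g * (X ^ m - 1) \<in> I" using kl by (simp add: right_diff_distrib)
    obtain e where "e > 0" "(X ^ e - 1) * (X ^ m - 1) \<in> I"
      using torsion_periodic[OF nT \<open>g > 0\<close> g] by blast
    then show False using no_torsion_periodic g \<open>g > 0\<close> \<open>m > 0\<close> by blast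
  next
    case False
    then have "\<kappa> > 1" using \<open>k' > 0\<close> \<open>l' > 0\<close> by (auto simp: \<kappa>_def)
    then obtain e a b where e: "e > 0"
      and ab: "of_nat (\<kappa> * a + 1) * X ^ (m * e) - of_nat (\<kappa> * b + 1) \<in> I"
      using not_grid_free[OF nN char0, of \<kappa> m] by auto
    define j j' where "j = \<kappa> * a + 1" and "j' = \<kappa> * b + 1"
    have jj: "of_nat j * X ^ (m * e) - of_nat j' \<in> I" using ab unfolding j_def j'_def .
    have nd: "\<not> \<kappa> dvd j" "\<not> \<kappa> dvd j'"
      unfolding j_def j'_def using \<open>\<kappa> > 1\<close>
      by (metis dvd_add_right_iff dvd_triv_left nat_dvd_1_iff_1 less_irrefl)+
    have "of_nat (l ^ e * j) - of_nat (k ^ e * j')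
       = of_nat (k ^ e) * (of_nat j * X ^ (m * e) - of_nat j')
         - of_nat j * ((of_nat k * X ^ m) ^ e - of_nat l ^ e)"
      by (simp only: of_nat_mult of_nat_power power_mult_distrib power_mult) (simp add: algebra_simps)
    then have "of_nat (l ^ e * j) - of_nat (k ^ e * j') \<in> I"
      using diff_mem mult_mem jj diff_power_mem[OF kl, of e] by metis
    then have "l ^ e * j = k ^ e * j'" by (rule char0')
    then have eq: "l' ^ e * j = k' ^ e * j'"
      using k' \<open>g > 0\<close> by (simp add: power_mult_distrib)
    have "k' dvd l' ^ e * j" "l' dvd k' ^ e * j'"
      using eq e by (metis dvd_mult2 dvd_power, metis dvd_mult2 dvd_power)
    then have "k' dvd j" "l' dvd j'"
      using k'(3) by (meson coprime_dvd_mult_right_iff coprime_power_right_iff coprime_commute)+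
    then show False using nd by (auto simp: \<kappa>_def split: if_splits)
  qed
qed

end

section \<open>Subgroups of finite index\<close>

lemma image_factor:
  assumes "\<And>x y. x \<in> A \<Longrightarrow> y \<in> A \<Longrightarrow> f x = f y \<Longrightarrow> g x = g y"
  shows "\<exists>k. g ` A = k ` f ` A"
proof -
  have "g x = (g \<circ> inv_into A f) (f x)" if "x \<in> A" for x
    using assms[of x "inv_into A f (f x)"] that by (simp add: inv_into_into f_inv_into_f)
  then have "g ` A = (g \<circ> inv_into A f) ` f ` A" by (force simp: image_image)
  then show ?thesis by blast
qed

lemma finite_image_factor:
  assumes "\<And>x y. x \<in> A \<Longrightarrow> y \<in> A \<Longrightarrow> f x = f y \<Longrightarrow> g x = g y" and "finite (f ` A)"
  shows "finite (g ` A)"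
  using image_factor[of A f g] assms by (metis finite_imageI)

lemma card_image_factor:
  assumes "\<And>x y. x \<in> A \<Longrightarrow> y \<in> A \<Longrightarrow> f x = f y \<Longrightarrow> g x = g y" and "finite (f ` A)"
  shows "card (g ` A) \<le> card (f ` A)"
  using image_factor[of A f g] assms by (metis card_image_le)

primrec set_power :: "('a, 'b) monoid_scheme \<Rightarrow> 'a set \<Rightarrow> nat \<Rightarrow> 'a set" where
  "set_power G F 0 = {\<one>\<^bsub>G\<^esub>}"
| "set_power G F (Suc n) = F <#>\<^bsub>G\<^esub> set_power G F n"

text \<open>\<open>H\<close> need not lie in \<Gamma>: for subgroups this says that the
  \<Gamma>-orbit of the base point of G/H is finite.\<close>

definition finite_index :: "('a, 'b) monoid_scheme \<Rightarrow> 'a set \<Rightarrow> 'a set \<Rightarrow> bool" where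
  "finite_index G \<Gamma> H \<longleftrightarrow> finite ((\<lambda>x. x <#\<^bsub>G\<^esub> H) ` \<Gamma>)"

definition finitely_generated :: "('a, 'b) monoid_scheme \<Rightarrow> 'a set \<Rightarrow> bool" where
  "finitely_generated G \<Gamma> \<longleftrightarrow> (\<exists>S. finite S \<and> S \<subseteq> carrier G \<and> \<Gamma> = generate G S)"

definition normalizes :: "('a, 'b) monoid_scheme \<Rightarrow> 'a set \<Rightarrow> 'a set \<Rightarrow> bool" where
  "normalizes G \<Gamma> N \<longleftrightarrow> (\<forall>g\<in>\<Gamma>. \<forall>x\<in>N. g \<otimes>\<^bsub>G\<^esub> x \<otimes>\<^bsub>G\<^esub> inv\<^bsub>G\<^esub> g \<in> N)"

text \<open>The bound is uniform in the base point \<open>g\<close>. Quantifying over all finite sets \<open>F\<close> absorbs the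
  change of generators and makes the notion inherited by subgroups of \<open>\<Gamma>\<close>, finitely generated or not.\<close>

definition subquadratic :: "('a, 'b) monoid_scheme \<Rightarrow> 'a set \<Rightarrow> 'a set \<Rightarrow> bool" where
  "subquadratic G \<Gamma> H \<longleftrightarrow> (\<forall>F C. finite F \<longrightarrow> F \<subseteq> \<Gamma> \<longrightarrow>
     (\<exists>n\<ge>C. \<forall>g\<in>\<Gamma>. C * card ((\<lambda>x. (x \<otimes>\<^bsub>G\<^esub> g) <#\<^bsub>G\<^esub> H) ` set_power G F n) \<le> n * n))"

context group
begin

lemma cancel_inv [simp]:
  "x \<in> carrier G \<Longrightarrow> y \<in> carrier G \<Longrightarrow> inv x \<otimes> (x \<otimes> y) = y"
  "x \<in> carrier G \<Longrightarrow> y \<in> carrier G \<Longrightarrow> x \<otimes> (inv x \<otimes> y) = y"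
  by (simp_all flip: m_assoc)

lemmas word_simps = m_assoc inv_mult_group

lemma l_coset_eq_iff:
  assumes "subgroup H G" "x \<in> carrier G" "y \<in> carrier G"
  shows "x <# H = y <# H \<longleftrightarrow> inv x \<otimes> y \<in> H"
proof
  assume *: "x <# H = y <# H"
  have "y \<in> y <# H" using assms subgroup.one_closed[OF assms(1)] by (force simp: l_coset_def)
  then obtain h where "h \<in> H" "y = x \<otimes> h" unfolding *[symmetric] by (auto simp: l_coset_def)
  then show "inv x \<otimes> y \<in> H" using assms subgroup.mem_carrier[OF assms(1)] by simp
next
  assume h: "inv x \<otimes> y \<in> H"
  have "y <# H = (x \<otimes> (inv x \<otimes> y)) <# H" using assms by simp
  also have "\<dots> = x <# ((inv x \<otimes> y) <# H)"
    using assms subgroup.subset by (metis inv_closed lcos_m_assoc m_closed)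
  also have "(inv x \<otimes> y) <# H = H"
    using coset_join3[OF _ assms(1) h] assms by simp
  finally show "x <# H = y <# H" ..
qed

lemma one_l_coset_eq_iff:
  assumes "subgroup H G" "x \<in> carrier G"
  shows "x <# H = \<one> <# H \<longleftrightarrow> x \<in> H"
  using l_coset_eq_iff[OF assms(1) one_closed assms(2)] assms by auto

lemma l_coset_mult_right:
  assumes "subgroup H G" "x \<in> carrier G" "h \<in> H"
  shows "(x \<otimes> h) <# H = x <# H"
proof -
  have "h \<in> carrier G" using subgroup.mem_carrier[OF assms(1,3)] .
  then show ?thesis
    using l_coset_eq_iff[OF assms(1,2), of "x \<otimes> h"] assms by simp
qed

lemma l_coset_mult_left_cong:
  assumes "subgroup H G" "x \<in> carrier G" "y \<in> carrier G" "z \<in> carrier G" "x <# H = y <# H"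
  shows "(z \<otimes> x) <# H = (z \<otimes> y) <# H"
  using assms by (metis lcos_m_assoc subgroup.subset)

lemma finite_index_mono:
  assumes "finite_index G \<Gamma> H" "subgroup H G" "subgroup H' G" "H \<subseteq> H'" "\<Gamma>' \<subseteq> \<Gamma>" "\<Gamma> \<subseteq> carrier G"
  shows "finite_index G \<Gamma>' H'"
  unfolding finite_index_def
proof (rule finite_image_factor[where f = "\<lambda>x. x <# H"])
  show "finite ((\<lambda>x. x <# H) ` \<Gamma>')"
    using assms(1,5) unfolding finite_index_def by (meson finite_subset image_mono)
  show "x <# H' = y <# H'" if "x \<in> \<Gamma>'" "y \<in> \<Gamma>'" "x <# H = y <# H" for x y
    using that assms l_coset_eq_iff[of H x y] l_coset_eq_iff[of H' x y] by blast
qed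

lemma finite_index_reps:
  assumes "finite_index G \<Gamma> H" "subgroup H G" "\<Gamma> \<subseteq> carrier G"
  obtains T where "finite T" "T \<subseteq> \<Gamma>" "\<And>x. x \<in> \<Gamma> \<Longrightarrow> \<exists>t\<in>T. inv t \<otimes> x \<in> H"
proof -
  obtain T where T: "T \<subseteq> \<Gamma>" "finite T" "(\<lambda>x. x <# H) ` \<Gamma> = (\<lambda>x. x <# H) ` T"
    using assms(1) unfolding finite_index_def by (metis finite_subset_image subset_refl)
  have "\<exists>t\<in>T. inv t \<otimes> x \<in> H" if "x \<in> \<Gamma>" for x
  proof -
    have "x <# H \<in> (\<lambda>x. x <# H) ` T" using that T(3) by blast
    then obtain t where "t \<in> T" "t <# H = x <# H" by auto
    then show ?thesis using l_coset_eq_iff[OF assms(2), of t x] that T(1) assms(3) by blast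
  qed
  then show thesis using that T by blast
qed

lemma finite_index_trans:
  assumes "finite_index G \<Gamma> \<Lambda>" "finite_index G \<Lambda> H" "subgroup \<Lambda> G" "subgroup H G" "\<Gamma> \<subseteq> carrier G"
  shows "finite_index G \<Gamma> H"
proof -
  obtain T where T: "finite T" "T \<subseteq> \<Gamma>" "\<And>x. x \<in> \<Gamma> \<Longrightarrow> \<exists>t\<in>T. inv t \<otimes> x \<in> \<Lambda>"
    using finite_index_reps[OF assms(1,3,5)] by blast
  have "(\<lambda>x. x <# H) ` \<Gamma> \<subseteq> (\<Union>t\<in>T. (\<lambda>C. t <# C) ` (\<lambda>x. x <# H) ` \<Lambda>)"
  proof clarify
    fix x assume x: "x \<in> \<Gamma>"
    then obtain t where t: "t \<in> T" "inv t \<otimes> x \<in> \<Lambda>" using T(3) by blast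
    then have c: "t \<in> carrier G" "x \<in> carrier G" using T(2) assms(5) x by auto
    then have "x <# H = t <# ((inv t \<otimes> x) <# H)"
      using assms(4) by (simp add: lcos_m_assoc subgroup.subset)
    then show "x <# H \<in> (\<Union>t\<in>T. (\<lambda>C. t <# C) ` (\<lambda>x. x <# H) ` \<Lambda>)" using t by blast
  qed
  then show ?thesis
    using T(1) assms(2) unfolding finite_index_def by (meson finite_UN_I finite_imageI finite_subset)
qed

lemma finite_index_Int:
  assumes "finite_index G \<Gamma> H" "finite_index G \<Gamma> K" "subgroup H G" "subgroup K G" "\<Gamma> \<subseteq> carrier G"
  shows "finite_index G \<Gamma> (H \<inter> K)"
  unfolding finite_index_def
proof (rule finite_image_factor[where f = "\<lambda>x. (x <# H, x <# K)"])
  have "(\<lambda>x. (x <# H, x <# K)) ` \<Gamma> \<subseteq> (\<lambda>x. x <# H) ` \<Gamma> \<times> (\<lambda>x. x <# K) ` \<Gamma>" by blast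
  then show "finite ((\<lambda>x. (x <# H, x <# K)) ` \<Gamma>)"
    using assms(1,2) unfolding finite_index_def by (meson finite_SigmaI finite_subset)
  show "x <# (H \<inter> K) = y <# (H \<inter> K)"
    if "x \<in> \<Gamma>" "y \<in> \<Gamma>" "(x <# H, x <# K) = (y <# H, y <# K)" for x y
    using that assms l_coset_eq_iff[of _ x y] subgroups_Inter_pair by (auto simp: subset_iff)
qed

text \<open>\<open>N\<close> is the kernel of the action of \<Gamma> on the finite set of cosets g
  \<Lambda> with g in \<Gamma>. Elements that induce the same map on this set agree modulo
  \<open>N\<close>, and there are only finitely many such maps.\<close>

lemma finite_index_core:
  assumes "finite_index G \<Gamma> \<Lambda>" "subgroup \<Gamma> G" "subgroup \<Lambda> G"
  obtains N where "subgroup N G" "N \<subseteq> \<Gamma>" "N \<subseteq> \<Lambda>" "normalizes G \<Gamma> N" "finite_index G \<Gamma> N"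
proof -
  interpret \<Gamma>: subgroup \<Gamma> G by fact
  interpret \<Lambda>: subgroup \<Lambda> G by fact
  define N where "N = {x \<in> \<Gamma>. \<forall>g\<in>\<Gamma>. inv g \<otimes> x \<otimes> g \<in> \<Lambda>}"
  have mult: "inv g \<otimes> (x \<otimes> y) \<otimes> g = (inv g \<otimes> x \<otimes> g) \<otimes> (inv g \<otimes> y \<otimes> g)"
    if "x \<in> \<Gamma>" "y \<in> \<Gamma>" "g \<in> \<Gamma>" for x y g
    using that by (simp add: word_simps)
  have inv: "inv g \<otimes> inv x \<otimes> g = inv (inv g \<otimes> x \<otimes> g)" if "x \<in> \<Gamma>" "g \<in> \<Gamma>" for x g
    using that by (simp add: word_simps)
  have sub: "subgroup N G"
  proof (rule subgroupI)
    show "N \<subseteq> carrier G" unfolding N_def by auto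
    have "\<one> \<in> N" unfolding N_def using \<Gamma>.one_closed by auto
    then show "N \<noteq> {}" by blast
    show "inv x \<in> N" if "x \<in> N" for x using that unfolding N_def by (auto simp: inv)
    show "x \<otimes> y \<in> N" if "x \<in> N" "y \<in> N" for x y using that unfolding N_def by (auto simp: mult)
  qed
  have "inv \<one> \<otimes> x \<otimes> \<one> \<in> \<Lambda>" if "x \<in> N" for x using that \<Gamma>.one_closed unfolding N_def by blast
  moreover have "inv \<one> \<otimes> x \<otimes> \<one> = x" if "x \<in> N" for x using that unfolding N_def by auto
  ultimately have "N \<subseteq> \<Lambda>" by force
  moreover have "normalizes G \<Gamma> N"
    unfolding normalizes_def
  proof (intro ballI)
    fix g x assume g: "g \<in> \<Gamma>" and x: "x \<in> N"
    then have "inv k \<otimes> (g \<otimes> x \<otimes> inv g) \<otimes> k = inv (inv g \<otimes> k) \<otimes> x \<otimes> (inv g \<otimes> k)" if "k \<in> \<Gamma>" for k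
      using that by (auto simp: word_simps N_def)
    then show "g \<otimes> x \<otimes> inv g \<in> N" using g x by (auto simp: N_def)
  qed
  moreover have "finite_index G \<Gamma> N"
    unfolding finite_index_def
  proof (rule finite_image_factor)
    let ?C = "(\<lambda>g. g <# \<Lambda>) ` \<Gamma>"
    let ?f = "\<lambda>x. restrict (\<lambda>C. x <# C) ?C"
    have "x <# (g <# \<Lambda>) \<in> ?C" if "x \<in> \<Gamma>" "g \<in> \<Gamma>" for x g
      using that by (subst lcos_m_assoc) (auto simp: \<Lambda>.subset)
    then have "?f ` \<Gamma> \<subseteq> ?C \<rightarrow>\<^sub>E ?C" by auto
    then show "finite (?f ` \<Gamma>)"
      using assms(1) unfolding finite_index_def by (metis finite_PiE finite_subset)
    fix x y assume xy: "x \<in> \<Gamma>" "y \<in> \<Gamma>" "?f x = ?f y"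
    have "inv g \<otimes> (inv x \<otimes> y) \<otimes> g \<in> \<Lambda>" if g: "g \<in> \<Gamma>" for g
    proof -
      have "x <# (g <# \<Lambda>) = y <# (g <# \<Lambda>)"
        using fun_cong[OF xy(3), of "g <# \<Lambda>"] g by simp
      then have "(x \<otimes> g) <# \<Lambda> = (y \<otimes> g) <# \<Lambda>" using g xy by (simp add: lcos_m_assoc \<Lambda>.subset)
      then show ?thesis
        using l_coset_eq_iff[OF assms(3), of "x \<otimes> g" "y \<otimes> g"] g xy by (simp add: word_simps)
    qed
    then have "inv x \<otimes> y \<in> N" using xy by (simp add: N_def)
    then show "x <# N = y <# N" using l_coset_eq_iff[OF sub] xy by simp
  qed
  ultimately show thesis using that sub by (force simp: N_def)
qed

lemma normalizes_mono: "normalizes G \<Gamma> N \<Longrightarrow> \<Gamma>' \<subseteq> \<Gamma> \<Longrightarrow> normalizes G \<Gamma>' N"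
  unfolding normalizes_def by blast

lemma normalizes_inv:
  assumes "normalizes G \<Gamma> N" "subgroup \<Gamma> G" "g \<in> \<Gamma>" "x \<in> N"
  shows "inv g \<otimes> x \<otimes> g \<in> N"
proof -
  have "inv g \<in> \<Gamma>" "inv (inv g) = g"
    using assms(2,3) by (auto simp: subgroup.m_inv_closed subgroup.mem_carrier)
  then show ?thesis using assms(1,4) unfolding normalizes_def by metis
qed

lemma subgroup_set_mult_normalizes:
  assumes "subgroup A G" "subgroup H G" "normalizes G H A"
  shows "subgroup (A <#> H) G"
proof -
  interpret A: subgroup A G by fact
  interpret H: subgroup H G by fact
  have mem: "x \<in> A <#> H \<longleftrightarrow> (\<exists>a\<in>A. \<exists>h\<in>H. x = a \<otimes> h)" for x by (auto simp: set_mult_def)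
  have conj: "h \<otimes> a \<otimes> inv h \<in> A" if "a \<in> A" "h \<in> H" for a h
    using assms(3) that unfolding normalizes_def by blast
  show ?thesis
  proof (rule subgroupI)
    show "A <#> H \<subseteq> carrier G" by (auto simp: mem)
    show "A <#> H \<noteq> {}" using A.one_closed H.one_closed mem by blast
  next
    fix x assume "x \<in> A <#> H"
    then obtain a h where "a \<in> A" "h \<in> H" "x = a \<otimes> h" by (auto simp: mem)
    then show "inv x \<in> A <#> H"
      using conj[of "inv a" "inv h"] unfolding mem
      by (intro bexI[of _ "inv h \<otimes> inv a \<otimes> h"] bexI[of _ "inv h"]) (auto simp: word_simps)
  next
    fix x y assume "x \<in> A <#> H" "y \<in> A <#> H"
    then obtain a h b k where "a \<in> A" "h \<in> H" "x = a \<otimes> h" "b \<in> A" "k \<in> H" "y = b \<otimes> k"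
      by (auto simp: mem)
    then show "x \<otimes> y \<in> A <#> H"
      using conj[of b h] unfolding mem
      by (intro bexI[of _ "a \<otimes> (h \<otimes> b \<otimes> inv h)"] bexI[of _ "h \<otimes> k"]) (auto simp: word_simps)
  qed
qed

text \<open>Schreier's argument: \<open>R\<close> is chosen so that the set \<open>M\<close> of
  products of an element of \<open>T\<close> and one generated by \<open>R\<close> is stable under
  left multiplication by the generators of \<Gamma>. The identity need not belong to
  \<open>T\<close>. So words are applied to the representative t0 of the trivial coset, and the
  elements of \<open>T\<close> in \<Lambda> are added to \<open>R\<close>.\<close>

lemma finitely_generated_finite_index:
  assumes "finitely_generated G \<Gamma>" "finite_index G \<Gamma> \<Lambda>" "subgroup \<Lambda> G" "\<Lambda> \<subseteq> \<Gamma>"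
  shows "finitely_generated G \<Lambda>"
proof -
  obtain S where S: "finite S" "S \<subseteq> carrier G" "\<Gamma> = generate G S"
    using assms(1) unfolding finitely_generated_def by blast
  then have "subgroup \<Gamma> G" using generate_is_subgroup by blast
  then interpret \<Gamma>: subgroup \<Gamma> G .
  interpret \<Lambda>: subgroup \<Lambda> G by fact
  obtain T where T: "finite T" "T \<subseteq> \<Gamma>" "\<And>x. x \<in> \<Gamma> \<Longrightarrow> \<exists>t\<in>T. inv t \<otimes> x \<in> \<Lambda>"
    using finite_index_reps[OF assms(2,3) \<Gamma>.subset] by blast
  define S' where "S' = S \<union> m_inv G ` S"
  have S': "S' \<subseteq> \<Gamma>" "finite S'"
    using S unfolding S'_def by (auto intro: generate.intros)
  define R where "R = ((\<lambda>(t', s, t). inv t' \<otimes> s \<otimes> t) ` (T \<times> S' \<times> T) \<union> T) \<inter> \<Lambda>"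
  have R: "finite R" "R \<subseteq> \<Lambda>" using T(1) S'(2) by (auto simp: R_def)
  interpret R: subgroup "generate G R" G
    using R(2) by (intro generate_is_subgroup) auto
  have RL: "generate G R \<subseteq> \<Lambda>" using generate_subgroup_incl[OF R(2) assms(3)] .
  define M where "M = T <#> generate G R"
  have mem: "x \<in> M \<longleftrightarrow> (\<exists>t\<in>T. \<exists>r\<in>generate G R. x = t \<otimes> r)" for x
    by (auto simp: M_def set_mult_def)
  have MG: "x \<in> carrier G" if "x \<in> M" for x
    using that T(2) \<Gamma>.subset R.subset by (auto simp: mem)
  have step: "s \<otimes> x \<in> M" if s: "s \<in> S'" and "x \<in> M" for s x
  proof -
    obtain t r where t: "t \<in> T" "r \<in> generate G R" "x = t \<otimes> r" using \<open>x \<in> M\<close> mem by blast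
    have sG: "s \<in> carrier G" "t \<in> carrier G" "s \<otimes> t \<in> \<Gamma>" using s t S' T(2) by auto
    then obtain t' where t': "t' \<in> T" "inv t' \<otimes> (s \<otimes> t) \<in> \<Lambda>" using T(3) by blast
    have t'G: "t' \<in> carrier G" using t' T(2) by auto
    have "inv t' \<otimes> s \<otimes> t \<in> R"
      using t' t s sG t'G unfolding R_def by (force simp: m_assoc)
    then have "inv t' \<otimes> s \<otimes> t \<otimes> r \<in> generate G R" using R.m_closed[OF generate.incl t(2)] by simp
    moreover have "s \<otimes> x = t' \<otimes> (inv t' \<otimes> s \<otimes> t \<otimes> r)"
      using t(2,3) sG t'G by (simp add: word_simps)
    ultimately show ?thesis using t'(1) mem by blast
  qed
  have act: "\<forall>x\<in>M. y \<otimes> x \<in> M" if "y \<in> generate G S" for y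
    using that
  proof induction
    case one
    then show ?case using MG by auto
  next
    case (incl h)
    then show ?case using step by (auto simp: S'_def)
  next
    case (inv h)
    then show ?case using step by (auto simp: S'_def)
  next
    case (eng h1 h2)
    have "h1 \<in> carrier G" "h2 \<in> carrier G" using eng(1,2) \<Gamma>.subset S(3) by auto
    then show ?case using eng MG by (auto simp: m_assoc)
  qed
  have "\<Lambda> \<subseteq> generate G R"
  proof
    fix x assume x: "x \<in> \<Lambda>"
    obtain t0 where t0: "t0 \<in> T" "inv t0 \<otimes> \<one> \<in> \<Lambda>" using T(3) \<Gamma>.one_closed by blast
    have t0c: "t0 \<in> carrier G" using t0 T(2) by auto
    have "inv (inv t0) \<in> \<Lambda>" using t0(2) t0c \<Lambda>.m_inv_closed by fastforce
    then have t0R: "t0 \<in> R" using t0(1) t0c by (auto simp: R_def)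
    have "x \<in> generate G S" using x assms(4) S(3) by blast
    moreover have "t0 \<in> M" using t0(1) t0c unfolding mem by (intro bexI[of _ t0] bexI[of _ \<one>]) auto
    ultimately obtain t r where tr: "t \<in> T" "r \<in> generate G R" "x \<otimes> t0 = t \<otimes> r"
      using act mem by meson
    have tG: "t \<in> carrier G" "x \<in> carrier G" using tr(1) T(2) x by auto
    have "t = x \<otimes> t0 \<otimes> inv r" using tr(2,3) tG t0c by (simp add: inv_solve_right)
    then have "t \<in> \<Lambda>" using x t0R R(2) RL tr(2) by (auto simp: subset_iff)
    then have "t \<in> generate G R" using tr(1) by (intro generate.incl) (simp add: R_def)
    moreover have "x = t \<otimes> r \<otimes> inv t0" using tr(2,3) tG t0c by (metis R.mem_carrier inv_solve_right m_closed)
    ultimately show "x \<in> generate G R"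
      using tr(2) generate.incl[OF t0R, of G] by simp
  qed
  then have "\<Lambda> = generate G R" using RL by (rule equalityI)
  moreover have "R \<subseteq> carrier G" using R(2) \<Lambda>.subset by (rule subset_trans)
  ultimately show ?thesis using R(1) unfolding finitely_generated_def by metis
qed

end

section \<open>Subquadratic actions\<close>

context group
begin

lemma commutator_mem_derived:
  assumes "x \<in> \<Gamma>" "y \<in> \<Gamma>"
  shows "x \<otimes> y \<otimes> inv x \<otimes> inv y \<in> derived G \<Gamma>"
  unfolding derived_def using assms by (intro generate.incl) auto

lemma normalizes_of_derived_subset:
  assumes "subgroup \<Gamma> G" "subgroup N G" "N \<subseteq> \<Gamma>" "derived G \<Gamma> \<subseteq> N"
  shows "normalizes G \<Gamma> N"
  unfolding normalizes_def
proof (intro ballI)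
  fix g x assume g: "g \<in> \<Gamma>" "x \<in> N"
  then have "g \<otimes> x \<otimes> inv g \<otimes> inv x \<in> N" using commutator_mem_derived assms by blast
  then have "g \<otimes> x \<otimes> inv g \<otimes> inv x \<otimes> x \<in> N" using g subgroup.m_closed[OF assms(2)] by blast
  moreover have "g \<in> carrier G" "x \<in> carrier G" using g assms(1,2) subgroup.mem_carrier by metis+
  ultimately show "g \<otimes> x \<otimes> inv g \<in> N" by (simp add: m_assoc)
qed

text \<open>The quotient of \<Gamma> by L Int \<Gamma> is a finitely generated abelian torsion
  group, hence finite. \<open>M\<close> grows by one generator at a time; a power of the new
  generator already lies in \<open>M\<close>, so only finitely many cosets are added.\<close>

lemma finite_index_of_torsion:
  assumes "finitely_generated G \<Gamma>" "subgroup L G" "derived G \<Gamma> \<subseteq> L"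
    and torsion: "\<And>t. t \<in> \<Gamma> \<Longrightarrow> \<exists>m>0. t [^] (m::nat) \<in> L"
  shows "finite_index G \<Gamma> L"
proof -
  obtain S where S: "finite S" "S \<subseteq> carrier G" "\<Gamma> = generate G S"
    using assms(1) unfolding finitely_generated_def by blast
  then have sub\<Gamma>: "subgroup \<Gamma> G" using generate_is_subgroup by blast
  interpret \<Gamma>: subgroup \<Gamma> G by (rule sub\<Gamma>)
  have "derived G \<Gamma> \<subseteq> \<Gamma>" by (rule derived_incl[OF subset_refl sub\<Gamma>])
  then have dL: "derived G \<Gamma> \<subseteq> L \<inter> \<Gamma>" using assms(3) by blast
  have subL: "subgroup (L \<inter> \<Gamma>) G" by (rule subgroups_Inter_pair[OF assms(2) sub\<Gamma>])
  have "\<exists>M. subgroup M G \<and> M \<subseteq> \<Gamma> \<and> S0 \<subseteq> M \<and> L \<inter> \<Gamma> \<subseteq> M \<and> finite_index G M (L \<inter> \<Gamma>)"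
    if "finite S0" "S0 \<subseteq> \<Gamma>" for S0
    using that
  proof induction
    case empty
    have "x <# (L \<inter> \<Gamma>) = \<one> <# (L \<inter> \<Gamma>)" if "x \<in> L \<inter> \<Gamma>" for x
      using one_l_coset_eq_iff[OF subL] that by auto
    then have "(\<lambda>x. x <# (L \<inter> \<Gamma>)) ` (L \<inter> \<Gamma>) \<subseteq> {\<one> <# (L \<inter> \<Gamma>)}" by blast
    then have "finite_index G (L \<inter> \<Gamma>) (L \<inter> \<Gamma>)"
      unfolding finite_index_def by (rule finite_subset) simp
    then show ?case using subL by (intro exI[of _ "L \<inter> \<Gamma>"]) auto
  next
    case (insert s S0)
    then obtain M where M: "subgroup M G" "M \<subseteq> \<Gamma>" "S0 \<subseteq> M" "L \<inter> \<Gamma> \<subseteq> M" "finite_index G M (L \<inter> \<Gamma>)"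
      by auto
    interpret M: subgroup M G by (rule M(1))
    have s: "s \<in> \<Gamma>" "s \<in> carrier G" using insert by auto
    have norm: "normalizes G \<Gamma> M" using normalizes_of_derived_subset[OF sub\<Gamma> M(1,2)] dL M(4) by blast
    define Z where "Z = generate G {s}"
    have Z: "Z = {s [^] k | k. k \<in> (UNIV :: int set)}" using generate_pow[OF s(2)] by (simp add: Z_def)
    have subZ: "subgroup Z G" unfolding Z_def using s by (intro generate_is_subgroup) simp
    have Z\<Gamma>: "Z \<subseteq> \<Gamma>" unfolding Z_def using s by (intro generate_subgroup_incl[OF _ sub\<Gamma>]) simp
    have sub: "subgroup (M <#> Z) G"
      using subgroup_set_mult_normalizes[OF M(1) subZ normalizes_mono[OF norm Z\<Gamma>]] .
    obtain m :: nat where m: "m > 0" "s [^] m \<in> L" using torsion s(1) by blast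
    have "finite_index G (M <#> Z) M"
      unfolding finite_index_def
    proof (rule finite_subset)
      show "(\<lambda>x. x <# M) ` (M <#> Z) \<subseteq> (\<lambda>i. (s [^] (i::int)) <# M) ` {0..<int m}"
      proof clarify
        fix x assume "x \<in> M <#> Z"
        then obtain a k where a: "a \<in> M" "x = a \<otimes> s [^] (k::int)" by (auto simp: set_mult_def Z)
        define i where "i = k mod int m"
        have z: "s [^] j \<in> \<Gamma>" for j :: int using Z Z\<Gamma> by blast
        have "s [^] m \<in> M" using m z[of "int m"] M(4) by (auto simp: int_pow_int)
        then have "(s [^] m) [^] (k div int m) \<in> M" by (rule subgroup_int_pow_closed[OF M(1)])
        moreover have "(s [^] m) [^] (k div int m) = s [^] (int m * (k div int m))"
          using s(2) by (simp add: int_pow_pow flip: int_pow_int)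
        moreover have "int m * (k div int m) = k - i" by (simp add: i_def minus_mod_eq_mult_div)
        ultimately have "s [^] (k - i) \<in> M" by simp
        moreover have "inv (s [^] i) \<otimes> a \<otimes> s [^] i \<in> M"
          by (rule normalizes_inv[OF norm sub\<Gamma> z a(1)])
        ultimately have "inv (s [^] i) \<otimes> a \<otimes> s [^] i \<otimes> s [^] (k - i) \<in> M" by simp
        moreover have "s [^] k = s [^] i \<otimes> s [^] (k - i)" using s(2) by (simp add: int_pow_mult[symmetric])
        ultimately have "inv (s [^] i) \<otimes> x \<in> M" using a s(2) by (simp add: m_assoc)
        then have "x <# M = (s [^] i) <# M"
          using l_coset_eq_iff[OF M(1), of "s [^] i" x] a s(2) by simp
        moreover have "i \<in> {0..<int m}" using m(1) by (simp add: i_def)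
        ultimately show "x <# M \<in> (\<lambda>i. (s [^] (i::int)) <# M) ` {0..<int m}" by blast
      qed
    qed simp
    then have "finite_index G (M <#> Z) (L \<inter> \<Gamma>)"
      using finite_index_trans M(1,5) subL subgroup.subset[OF sub] by blast
    moreover have "M <#> Z \<subseteq> \<Gamma>" using M(2) Z\<Gamma> by (auto simp: set_mult_def)
    moreover have MZ: "M \<subseteq> M <#> Z"
    proof
      fix x assume "x \<in> M"
      then have "x = x \<otimes> \<one>" by simp
      then show "x \<in> M <#> Z" unfolding set_mult_def using \<open>x \<in> M\<close> subgroup.one_closed[OF subZ] by blast
    qed
    moreover have "s \<in> M <#> Z"
    proof -
      have "s \<in> Z" unfolding Z_def by (intro generate.incl) simp
      moreover have "s = \<one> \<otimes> s" using s by simp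
      ultimately show ?thesis unfolding set_mult_def using M.one_closed by blast
    qed
    ultimately show ?case using sub M(3,4) by (intro exI[of _ "M <#> Z"]) auto
  qed
  note ex = this
  have "S \<subseteq> \<Gamma>" unfolding S(3) by (auto intro: generate.incl)
  from ex[OF S(1) this]
  obtain M where M: "subgroup M G" "S \<subseteq> M" "finite_index G M (L \<inter> \<Gamma>)" "M \<subseteq> \<Gamma>"
    by (elim exE conjE)
  have "\<Gamma> \<subseteq> M" unfolding S(3) by (rule generate_subgroup_incl[OF M(2,1)])
  then show ?thesis
    using finite_index_mono[OF M(3) subL assms(2) Int_lower1 _ subgroup.subset[OF M(1)]] by blast
qed

section \<open>Products of elements of a finite set, and growth of orbits\<close>

lemma set_power_subset:
  assumes "subgroup \<Gamma> G" "F \<subseteq> \<Gamma>"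
  shows "set_power G F n \<subseteq> \<Gamma>"
  using assms subgroup.m_closed[OF assms(1)] subgroup.one_closed[OF assms(1)]
  by (induction n) (auto simp: set_mult_def)

lemma finite_set_power: "finite F \<Longrightarrow> finite (set_power G F n)"
  by (induction n) (auto simp: set_mult_def)

lemma set_power_add:
  assumes "F \<subseteq> carrier G" "x \<in> set_power G F m" "y \<in> set_power G F n"
  shows "x \<otimes> y \<in> set_power G F (m + n)"
  using assms(2)
proof (induction m arbitrary: x)
  case 0
  then show ?case using assms(3) set_power_subset[OF subgroup_self assms(1), of n] by auto
next
  case (Suc m)
  then obtain s z where s: "s \<in> F" "z \<in> set_power G F m" "x = s \<otimes> z" by (auto simp: set_mult_def)
  have "s \<in> carrier G" "z \<in> carrier G" "y \<in> carrier G"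
    using s assms set_power_subset[OF subgroup_self assms(1)] by blast+
  then have "x \<otimes> y = s \<otimes> (z \<otimes> y)" using s(3) by (simp add: m_assoc)
  then show ?case using s(1) Suc.IH[OF s(2)] by (auto simp: set_mult_def)
qed

lemma set_power_one:
  assumes "F \<subseteq> carrier G" "x \<in> F"
  shows "x \<in> set_power G F 1"
  using assms by (force simp: set_mult_def)

lemma set_power_mono:
  assumes "\<one> \<in> F" "F \<subseteq> carrier G" "m \<le> n"
  shows "set_power G F m \<subseteq> set_power G F n"
  using assms(3)
proof (induction n rule: dec_induct)
  case (step n)
  have "x \<in> set_power G F (Suc n)" if "x \<in> set_power G F n" for x
    using set_power_add[OF assms(2) set_power_one[OF assms(2,1)] that]
      set_power_subset[OF subgroup_self assms(2), of n] that by auto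
  then show ?case using step by blast
qed simp

lemma set_power_mono_set: "F \<subseteq> F' \<Longrightarrow> set_power G F n \<subseteq> set_power G F' n"
  by (induction n) (auto simp: set_mult_def)

lemma set_power_pow:
  assumes "F \<subseteq> carrier G" "x \<in> F" "\<one> \<in> F" "i \<le> n"
  shows "x [^] (i::nat) \<in> set_power G F n"
proof -
  have "x [^] (i::nat) \<in> set_power G F i" for i
  proof (induction i)
    case (Suc i)
    then show ?case using set_power_add[OF assms(1) Suc set_power_one[OF assms(1,2)]] by simp
  qed simp
  then show ?thesis using set_power_mono[OF assms(3,1,4)] by blast
qed

lemma subquadratic_mono:
  assumes "subquadratic G \<Gamma> H" "subgroup H G" "subgroup H' G" "H \<subseteq> H'" "subgroup \<Gamma> G"
  shows "subquadratic G \<Gamma> H'"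
  unfolding subquadratic_def
proof (intro allI impI)
  fix F C assume F: "finite F" "F \<subseteq> \<Gamma>"
  obtain n where n: "n \<ge> C" "\<And>g. g \<in> \<Gamma> \<Longrightarrow>
      C * card ((\<lambda>x. (x \<otimes> g) <# H) ` set_power G F n) \<le> n * n"
    using assms(1)[unfolded subquadratic_def, rule_format, OF F, of C] by auto
  have "C * card ((\<lambda>x. (x \<otimes> g) <# H') ` set_power G F n) \<le> n * n" if g: "g \<in> \<Gamma>" for g
  proof (rule order_trans[OF mult_le_mono2 n(2)[OF g]])
    show "card ((\<lambda>x. (x \<otimes> g) <# H') ` set_power G F n) \<le> card ((\<lambda>x. (x \<otimes> g) <# H) ` set_power G F n)"
    proof (rule card_image_factor)
      fix x y assume xy: "x \<in> set_power G F n" "y \<in> set_power G F n"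
        and e: "(x \<otimes> g) <# H = (y \<otimes> g) <# H"
      have "z \<in> carrier G" if "z \<in> set_power G F n \<or> z = g" for z
        using that set_power_subset[OF assms(5) F(2)] subgroup.mem_carrier[OF assms(5)] g by (metis subsetD)
      then have c: "x \<otimes> g \<in> carrier G" "y \<otimes> g \<in> carrier G" using xy by simp_all
      from e have "inv (x \<otimes> g) \<otimes> (y \<otimes> g) \<in> H" unfolding l_coset_eq_iff[OF assms(2) c] .
      then show "(x \<otimes> g) <# H' = (y \<otimes> g) <# H'"
        unfolding l_coset_eq_iff[OF assms(3) c] by (rule subsetD[OF assms(4)])
    qed (rule finite_imageI[OF finite_set_power[OF F(1)]])
  qed
  then show "\<exists>n\<ge>C. \<forall>g\<in>\<Gamma>. C * card ((\<lambda>x. (x \<otimes> g) <# H') ` set_power G F n) \<le> n * n"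
    using n(1) by blast
qed

text \<open>This is the form in which subquadratic growth gets contradicted: it is enough to
  exhibit, for every p, p * p points that are reached by words of length k * p from one base
  point.\<close>

lemma subquadratic_bound:
  assumes "subquadratic G \<Gamma> H" "finite F" "F \<subseteq> \<Gamma>" "\<one> \<in> F" "k > 0" "\<Gamma> \<subseteq> carrier G"
  obtains p where "p > 0" "\<And>g. g \<in> \<Gamma> \<Longrightarrow> card ((\<lambda>x. (x \<otimes> g) <# H) ` set_power G F (k * p)) < p * p"
proof -
  \<comment> \<open>With p = n div k one has n \<le> 2 k p, so p^2 points would force C p^2 \<le> 4
    k^2 p^2. The extra summand k makes this false; it also gives k \<le> n, hence p > 0.\<close>
  define C where "C = 4 * (k * k) + k"
  obtain n where n: "n \<ge> C" "\<And>g. g \<in> \<Gamma> \<Longrightarrow>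
      C * card ((\<lambda>x. (x \<otimes> g) <# H) ` set_power G F n) \<le> n * n"
    using assms(1)[unfolded subquadratic_def, rule_format, OF assms(2,3), of C] by auto
  define p where "p = n div k"
  have "k \<le> n" using n(1) by (simp add: C_def)
  then have p: "p > 0" "k * p \<le> n" using assms(5) by (auto simp: p_def div_greater_zero_iff)
  have "n = k * p + n mod k" by (simp add: p_def)
  moreover have "n mod k < k" "k \<le> k * p" using assms(5) p(1) by auto
  ultimately have n2: "n \<le> 2 * (k * p)" by linarith
  have "card ((\<lambda>x. (x \<otimes> g) <# H) ` set_power G F (k * p)) < p * p" if g: "g \<in> \<Gamma>" for g
  proof (rule ccontr)
    let ?c = "card ((\<lambda>x. (x \<otimes> g) <# H) ` set_power G F n)"
    have "card ((\<lambda>x. (x \<otimes> g) <# H) ` set_power G F (k * p)) \<le> ?c"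
      using finite_set_power[OF assms(2)] set_power_mono[OF assms(4) subset_trans[OF assms(3,6)] p(2)]
      by (intro card_mono finite_imageI image_mono)
    moreover assume "\<not> ?thesis"
    ultimately have "p * p \<le> ?c" by linarith
    then have "C * (p * p) \<le> n * n" using n(2)[OF g] by (meson le_trans mult_le_mono2)
    also have "n * n \<le> 2 * (k * p) * (2 * (k * p))" using n2 by (intro mult_le_mono)
    finally have "4 * (k * k) * (p * p) + k * (p * p) \<le> 4 * (k * k) * (p * p)"
      by (simp add: C_def algebra_simps)
    then show False using p(1) assms(5) by simp
  qed
  then show thesis using that p(1) by blast
qed

text \<open>If no new point appeared from one radius to the next, the points reached so far would be
  closed under the generators and their inverses. They would then be the whole orbit, which is
  infinite.\<close>

lemma orbit_growth_linear:
  assumes "finite S" "S \<subseteq> carrier G" "subgroup H G" "\<not> finite_index G (generate G S) H"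
    and g: "g \<in> generate G S"
  shows "n < card ((\<lambda>x. (x \<otimes> g) <# H) ` set_power G (insert \<one> (S \<union> m_inv G ` S)) n)"
proof (induction n)
  case 0
  then show ?case by simp
next
  case (Suc n)
  let ?F = "insert \<one> (S \<union> m_inv G ` S)" and ?f = "\<lambda>x. (x \<otimes> g) <# H"
  have F: "finite ?F" "?F \<subseteq> carrier G" using assms(1,2) by auto
  have gc: "g \<in> carrier G" using g generate_in_carrier[OF assms(2)] by blast
  have pc: "x \<in> carrier G" if "x \<in> set_power G ?F n" for x n
    using that set_power_subset[OF subgroup_self F(2)] by blast
  have sub: "?f ` set_power G ?F n \<subseteq> ?f ` set_power G ?F (Suc n)"
    using set_power_mono[of ?F n "Suc n"] F(2) by (intro image_mono) simp
  have "?f ` set_power G ?F n \<noteq> ?f ` set_power G ?F (Suc n)"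
  proof
    assume eq: "?f ` set_power G ?F n = ?f ` set_power G ?F (Suc n)"
    define D where "D = ?f ` set_power G ?F n"
    have step: "(s \<otimes> y) <# H \<in> D" if s: "s \<in> ?F" and y: "y \<in> carrier G" "y <# H \<in> D" for s y
    proof -
      obtain x where x: "x \<in> set_power G ?F n" "y <# H = (x \<otimes> g) <# H" using y(2) by (auto simp: D_def)
      have sc: "s \<in> carrier G" using s F by blast
      have e1: "(s \<otimes> y) <# H = (s \<otimes> (x \<otimes> g)) <# H"
        using m_closed[OF pc[OF x(1)] gc] by (rule l_coset_mult_left_cong[OF assms(3) y(1) _ sc x(2)])
      have e2: "(s \<otimes> (x \<otimes> g)) <# H = ?f (s \<otimes> x)" using sc gc pc[OF x(1)] by (simp add: m_assoc)
      have "s \<otimes> x \<in> set_power G ?F (Suc n)"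
        unfolding set_power.simps set_mult_def using s x(1) by blast
      then have "?f (s \<otimes> x) \<in> D" unfolding D_def eq by (rule imageI)
      then show ?thesis unfolding e1 e2 .
    qed
    have "\<forall>y\<in>carrier G. y <# H \<in> D \<longrightarrow> (z \<otimes> y) <# H \<in> D" if "z \<in> generate G S" for z
      using that
    proof induction
      case (eng h1 h2)
      have "h1 \<in> carrier G" "h2 \<in> carrier G" using eng(1,2) generate_in_carrier[OF assms(2)] by auto
      then show ?case using eng(3,4) by (auto simp: m_assoc)
    qed (use step in auto)
    moreover have "g <# H \<in> D"
    proof -
      have "\<one> \<in> set_power G ?F n" using set_power_mono[of ?F 0 n] F(2) by auto
      then show ?thesis unfolding D_def using gc by (force intro: image_eqI[of _ _ \<one>])
    qed
    ultimately have z: "(z \<otimes> g) <# H \<in> D" if "z \<in> generate G S" for z using gc that by blast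
    have "x <# H \<in> D" if x: "x \<in> generate G S" for x
    proof -
      have "inv g \<in> generate G S" using generate_m_inv_closed[OF assms(2) g] .
      then have "x \<otimes> inv g \<in> generate G S" using x generate.eng by metis
      moreover have "x \<otimes> inv g \<otimes> g = x" using x gc generate_in_carrier[OF assms(2)] by (simp add: m_assoc)
      ultimately show ?thesis using z by metis
    qed
    then have "(\<lambda>x. x <# H) ` generate G S \<subseteq> D" by blast
    moreover have "finite D" unfolding D_def using finite_set_power[OF F(1)] by blast
    ultimately show False using assms(4) unfolding finite_index_def by (meson finite_subset)
  qed
  then have "card (?f ` set_power G ?F n) < card (?f ` set_power G ?F (Suc n))"
    using sub finite_set_power[OF F(1)] by (intro psubset_card_mono) blast+
  then show ?case using Suc by linarith
qed

lemma conj_pow: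
  assumes "a \<in> carrier G" "g \<in> carrier G"
  shows "(inv g \<otimes> a \<otimes> g) [^] (n::nat) = inv g \<otimes> a [^] n \<otimes> g"
  using assms by (induction n) (auto simp: word_simps)

text \<open>If the orbits of \<open>a\<close> were unbounded, then moving linearly many points of a long orbit segment of
  \<open>a\<close> to linearly many different \<open>K\<close>-orbits would give quadratic growth.\<close>

lemma subquadratic_torsion:
  assumes fg: "finitely_generated G \<Gamma>" and sub: "subgroup K G" "subgroup H G" "subgroup H' G"
    and K: "normalizes G \<Gamma> K" "K \<subseteq> \<Gamma>" "K \<subseteq> H'" "H \<subseteq> H'"
    and H': "\<not> finite_index G \<Gamma> H'" and sq: "subquadratic G \<Gamma> H" and a: "a \<in> K"
  shows "\<exists>m>0. \<forall>g\<in>\<Gamma>. inv g \<otimes> a [^] (m::nat) \<otimes> g \<in> H"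
proof -
  obtain S where S: "finite S" "S \<subseteq> carrier G" "\<Gamma> = generate G S"
    using fg unfolding finitely_generated_def by blast
  then have sub\<Gamma>: "subgroup \<Gamma> G" using generate_is_subgroup by blast
  interpret \<Gamma>: subgroup \<Gamma> G by (rule sub\<Gamma>)
  interpret K: subgroup K G by (rule sub(1))
  interpret H': subgroup H' G by (rule sub(3))
  interpret H: subgroup H G by (rule sub(2))
  define F0 where "F0 = insert \<one> (S \<union> m_inv G ` S)"
  have F0: "finite F0" "F0 \<subseteq> \<Gamma>" "\<one> \<in> F0"
    using S by (auto simp: F0_def intro: generate.intros)
  define F where "F = insert a F0"
  have F: "finite F" "F \<subseteq> \<Gamma>" "\<one> \<in> F" "F \<subseteq> carrier G" "a \<in> F" "F0 \<subseteq> F"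
    using F0 a K(2) by (auto simp: F_def)
  obtain p where p: "p > 0"
    "\<And>g. g \<in> \<Gamma> \<Longrightarrow> card ((\<lambda>x. (x \<otimes> g) <# H) ` set_power G F (2 * p)) < p * p"
    using subquadratic_bound[OF sq F(1-3), of 2] \<Gamma>.subset by auto
  have small: "\<exists>i. 0 < i \<and> i \<le> p \<and> inv g \<otimes> a [^] i \<otimes> g \<in> H" if g: "g \<in> \<Gamma>" for g
  proof (rule ccontr)
    assume none: "\<not> ?thesis"
    let ?D = "(\<lambda>x. (x \<otimes> g) <# H') ` set_power G F0 p"
    have D: "p < card ?D" unfolding F0_def 
      using orbit_growth_linear[OF S(1,2) sub(3) H'[unfolded S(3)] g[unfolded S(3)]] .
    define r where "r = inv_into (set_power G F0 p) (\<lambda>x. (x \<otimes> g) <# H')"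
    have r: "r C \<in> set_power G F0 p" "(r C \<otimes> g) <# H' = C" if "C \<in> ?D" for C
      unfolding r_def by (rule inv_into_into[OF that], rule f_inv_into_f[OF that])
    have rc: "r C \<in> carrier G" if "C \<in> ?D" for C
      by (rule \<Gamma>.mem_carrier[OF subsetD[OF set_power_subset[OF sub\<Gamma> F0(2)] r(1)[OF that]]])
    have gc: "g \<in> carrier G" using g by simp
    have ac: "a \<in> carrier G" using a by simp
    \<comment> \<open>\<open>a\<close> acts before \<open>r C\<close>. Conjugates of its powers by
      \<open>g\<close> lie in \<open>K\<close>, hence in \<open>H'\<close>, so the segment belonging
      to \<open>C\<close> stays in the \<open>H'\<close>-coset \<open>C\<close>. Thus different C
      are separated modulo \<open>H'\<close>, and points with the same C by the assumption that no
      a^i with 0 < i \<le> p fixes the coset of \<open>g\<close>.\<close>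
    let ?h = "\<lambda>(C, j). (r C \<otimes> a [^] (j::nat) \<otimes> g) <# H"
    have inj: "inj_on ?h (?D \<times> {..<p})"
    proof -
      have "C = C'" and "i \<le> j \<Longrightarrow> i = j"
        if C: "C \<in> ?D" "C' \<in> ?D" and ij: "i < p" "j < p"
          and e: "(r C \<otimes> a [^] (i::nat) \<otimes> g) <# H = (r C' \<otimes> a [^] (j::nat) \<otimes> g) <# H" for C C' i j
      proof -
        have e': "inv (r C \<otimes> a [^] i \<otimes> g) \<otimes> (r C' \<otimes> a [^] j \<otimes> g) \<in> H"
          using e l_coset_eq_iff[OF sub(2)] rc C gc ac by simp
        have pow: "inv g \<otimes> a [^] k \<otimes> g \<in> H'" for k :: nat
        proof -
          have "a [^] k \<in> K" using a by (induction k) simp_all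
          from normalizes_inv[OF K(1) sub\<Gamma> g this] show ?thesis by (rule subsetD[OF K(3)])
        qed
        have "inv (r C \<otimes> g) \<otimes> (r C' \<otimes> g)
          = (inv g \<otimes> a [^] i \<otimes> g) \<otimes> (inv (r C \<otimes> a [^] i \<otimes> g) \<otimes> (r C' \<otimes> a [^] j \<otimes> g))
            \<otimes> inv (inv g \<otimes> a [^] j \<otimes> g)"
          using rc C gc ac by (simp add: word_simps)
        also have "\<dots> \<in> H'"
          by (rule H'.m_closed[OF H'.m_closed[OF pow subsetD[OF K(4) e']] H'.m_inv_closed[OF pow]])
        finally have "(r C \<otimes> g) <# H' = (r C' \<otimes> g) <# H'"
          using l_coset_eq_iff[OF sub(3)] rc C gc by simp
        then show CC: "C = C'" using r(2) C by simp
        assume "i \<le> j"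
        then have aj: "a [^] j = a [^] i \<otimes> a [^] (j - i)" using ac by (simp add: nat_pow_mult)
        have e2: "inv (r C \<otimes> a [^] i \<otimes> g) \<otimes> (r C' \<otimes> a [^] j \<otimes> g) = inv g \<otimes> a [^] (j - i) \<otimes> g"
          unfolding aj CC using rc C gc ac by (simp add: word_simps)
        have "inv g \<otimes> a [^] (j - i) \<otimes> g \<in> H" using e' unfolding e2 .
        then have "\<not> (0 < j - i \<and> j - i \<le> p)" using none by blast
        then show "i = j" using \<open>i \<le> j\<close> ij by linarith
      qed
      note C_eq = this
      show ?thesis
      proof (rule inj_onI)
        fix u v assume uv: "u \<in> ?D \<times> {..<p}" "v \<in> ?D \<times> {..<p}" "?h u = ?h v"
        obtain C i C' j where uv_eq: "u = (C, i)" "v = (C', j)" by (metis surj_pair)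
        have C: "C \<in> ?D" "C' \<in> ?D" and ij: "i \<in> {..<p}" "j \<in> {..<p}"
          using uv(1,2) unfolding uv_eq mem_Sigma_iff by blast+
        have e: "(r C \<otimes> a [^] i \<otimes> g) <# H = (r C' \<otimes> a [^] j \<otimes> g) <# H"
          using uv(3) unfolding uv_eq case_prod_conv .
        have "i \<le> j \<Longrightarrow> i = j" "j \<le> i \<Longrightarrow> j = i"
          using C_eq(2)[OF C ij[unfolded lessThan_iff] e]
            C_eq(2)[OF C(2,1) ij(2,1)[unfolded lessThan_iff] e[symmetric]] by blast+
        moreover have "C = C'" by (rule C_eq(1)[OF C ij[unfolded lessThan_iff] e])
        ultimately show "u = v" unfolding uv_eq by (metis nat_le_linear)
      qed
    qed
    have "?h ` (?D \<times> {..<p}) \<subseteq> (\<lambda>x. (x \<otimes> g) <# H) ` set_power G F (2 * p)"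
    proof (rule image_subsetI)
      fix u assume "u \<in> ?D \<times> {..<p}"
      then obtain C j where u: "u = (C, j)" "C \<in> ?D" and j: "j < p" by auto
      have "r C \<in> set_power G F p" using r(1)[OF u(2)] set_power_mono_set[OF F(6)] by (rule rev_subsetD)
      moreover have "a [^] j \<in> set_power G F p" using set_power_pow[OF F(4,5,3)] j by simp
      ultimately have "r C \<otimes> a [^] j \<in> set_power G F (2 * p)"
        using set_power_add[OF F(4)] by (metis mult_2)
      then show "?h u \<in> (\<lambda>x. (x \<otimes> g) <# H) ` set_power G F (2 * p)"
        unfolding u(1) case_prod_conv by (rule imageI)
    qed
    then have "card (?D \<times> {..<p}) \<le> card ((\<lambda>x. (x \<otimes> g) <# H) ` set_power G F (2 * p))"
      using card_image[OF inj] finite_set_power[OF F(1)] by (metis (no_types, lifting) card_mono finite_imageI)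
    then have "card ?D * p \<le> card ((\<lambda>x. (x \<otimes> g) <# H) ` set_power G F (2 * p))"
      by (simp only: card_cartesian_product card_lessThan)
    from le_less_trans[OF this p(2)[OF g]] have "card ?D < p" unfolding mult_less_cancel2 by (rule conjunct2)
    then show False using D by (rule less_asym)
  qed
  \<comment> \<open>The bound \<open>p\<close> does not depend on \<open>g\<close>, so the one
    exponent p! is a multiple of all the exponents i.\<close>
  show ?thesis
  proof (intro exI[of _ "fact p"] conjI ballI)
    fix g assume g: "g \<in> \<Gamma>"
    then obtain i where i: "0 < i" "i \<le> p" "inv g \<otimes> a [^] i \<otimes> g \<in> H" using small by blast
    have "i dvd fact p" using i by (simp add: dvd_fact)
    then obtain q where q: "fact p = i * q" by blast
    have "(inv g \<otimes> a [^] i \<otimes> g) [^] q \<in> H" using i(3) by (induction q) simp_all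
    then show "inv g \<otimes> a [^] (fact p :: nat) \<otimes> g \<in> H"
      using g a conj_pow[of "a [^] i" g q] by (simp add: nat_pow_pow q)
  qed simp
qed

end

section \<open>Affine actions on abelian groups\<close>

text \<open>The cosets x H with x in A form the abelian group A/(A Int H). On it A acts by
  translations and H by conjugation, which together is the affine action of A H.\<close>

locale abelian_orbit = group G for G (structure) +
  fixes A H :: "'a set"
  assumes A: "subgroup A G" and H: "subgroup H G"
    and norm: "normalizes G H A" and A_der: "derived G A \<subseteq> H"
begin

sublocale A: subgroup A G by (rule A)
sublocale H: subgroup H G by (rule H)

lemma coset_commute:
  assumes "x \<in> A" "y \<in> A"
  shows "(x \<otimes> y) <# H = (y \<otimes> x) <# H"
proof -
  have "inv y \<otimes> inv x \<otimes> inv (inv y) \<otimes> inv (inv x) \<in> H"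
    using commutator_mem_derived[of "inv y" A "inv x"] A_der assms by auto
  then show ?thesis
    using l_coset_eq_iff[OF H, of "x \<otimes> y" "y \<otimes> x"] assms by (simp add: word_simps)
qed

lemma coset_mult_cong:
  assumes "x \<in> A" "x' \<in> A" "y \<in> A" "y' \<in> A" "x <# H = x' <# H" "y <# H = y' <# H"
  shows "(x \<otimes> y) <# H = (x' \<otimes> y') <# H"
proof -
  have "(x \<otimes> y) <# H = (x \<otimes> y') <# H"
    by (rule l_coset_mult_left_cong[OF H _ _ _ assms(6)]) (simp_all add: assms)
  also have "\<dots> = (y' \<otimes> x) <# H" by (rule coset_commute[OF assms(1,4)])
  also have "\<dots> = (y' \<otimes> x') <# H"
    by (rule l_coset_mult_left_cong[OF H _ _ _ assms(5)]) (simp_all add: assms)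
  also have "\<dots> = (x' \<otimes> y') <# H" by (rule coset_commute[OF assms(4,2)])
  finally show ?thesis .
qed

lemma coset_eqI:
  assumes "x \<in> A" "y \<in> A" "x \<otimes> inv y \<in> H"
  shows "x <# H = y <# H"
proof -
  have "x <# H = (x \<otimes> inv y \<otimes> y) <# H" using assms by (simp add: m_assoc)
  also have "\<dots> = (y \<otimes> (x \<otimes> inv y)) <# H" using assms by (intro coset_commute) simp_all
  also have "\<dots> = y <# H" using assms by (intro l_coset_mult_right[OF H]) simp_all
  finally show ?thesis .
qed

lemma conj_mem_A: "g \<in> A <#> H \<Longrightarrow> x \<in> A \<Longrightarrow> g \<otimes> x \<otimes> inv g \<in> A"
proof -
  assume g: "g \<in> A <#> H" and x: "x \<in> A"
  obtain b k where b: "b \<in> A" "k \<in> H" "g = b \<otimes> k" using g by (auto simp: set_mult_def)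
  have "k \<otimes> x \<otimes> inv k \<in> A" using norm b(2) x unfolding normalizes_def by blast
  then have "b \<otimes> (k \<otimes> x \<otimes> inv k) \<otimes> inv b \<in> A" using b(1) by simp
  then show ?thesis using b x by (simp add: word_simps)
qed

lemma normalizes_Int: "normalizes G (A <#> H) (A \<inter> H)"
  unfolding normalizes_def
proof (intro ballI IntI)
  fix g x assume g: "g \<in> A <#> H" and x: "x \<in> A \<inter> H"
  obtain b k where b: "b \<in> A" "k \<in> H" "g = b \<otimes> k" using g by (auto simp: set_mult_def)
  define y where "y = k \<otimes> x \<otimes> inv k"
  have y: "y \<in> A" "y \<in> H" using norm b(2) x unfolding normalizes_def y_def by simp_all
  have "b \<otimes> y \<otimes> inv b \<otimes> inv y \<in> H" using commutator_mem_derived[OF b(1) y(1)] A_der by auto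
  then have "b \<otimes> y \<otimes> inv b \<otimes> inv y \<otimes> y \<in> H" using y(2) by simp
  then show "g \<otimes> x \<otimes> inv g \<in> H" using b x y by (simp add: word_simps y_def)
  show "g \<otimes> x \<otimes> inv g \<in> A" using g x by (simp add: conj_mem_A)
qed

lemma subgroup_AH: "subgroup (A <#> H) G"
  by (rule subgroup_set_mult_normalizes[OF A H norm])

lemma subgroup_Int: "subgroup (A \<inter> H) G"
  by (rule subgroups_Inter_pair[OF A H])

lemma A_subset: "A \<subseteq> A <#> H"
proof
  fix x assume "x \<in> A"
  then have "x = x \<otimes> \<one>" by simp
  then show "x \<in> A <#> H" unfolding set_mult_def using \<open>x \<in> A\<close> H.one_closed by blast
qed

lemma H_subset: "H \<subseteq> A <#> H"
proof
  fix x assume "x \<in> H"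
  then have "x = \<one> \<otimes> x" by simp
  then show "x \<in> A <#> H" unfolding set_mult_def using \<open>x \<in> H\<close> A.one_closed by blast
qed

text \<open>The stabilizer of the class of \<open>a\<close> under the linear part of the affine
  action, that is, under conjugation of A H on A/(A Int H).\<close>

definition conj_stabilizer :: "'a \<Rightarrow> 'a set" where
  "conj_stabilizer a = {g \<in> A <#> H. g \<otimes> a \<otimes> inv g \<otimes> inv a \<in> A \<inter> H}"

lemma A_subset_conj_stabilizer:
  assumes "a \<in> A"
  shows "A \<subseteq> conj_stabilizer a"
  using A_subset commutator_mem_derived[OF _ assms, of _] A_der assms
  by (auto simp: conj_stabilizer_def)

lemma subgroup_conj_stabilizer:
  assumes "a \<in> A"
  shows "subgroup (conj_stabilizer a) G"
proof (rule subgroupI)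
  interpret AH: subgroup "A <#> H" G by (rule subgroup_AH)
  interpret B: subgroup "A \<inter> H" G by (rule subgroup_Int)
  show "conj_stabilizer a \<subseteq> carrier G" by (auto simp: conj_stabilizer_def)
  show "conj_stabilizer a \<noteq> {}" using A_subset_conj_stabilizer[OF assms] A.one_closed by blast
  show "inv g \<in> conj_stabilizer a" if "g \<in> conj_stabilizer a" for g
  proof -
    have g: "g \<in> A <#> H" "g \<otimes> a \<otimes> inv g \<otimes> inv a \<in> A \<inter> H"
      using that by (simp_all only: conj_stabilizer_def mem_Collect_eq)
    have "inv g \<otimes> inv (g \<otimes> a \<otimes> inv g \<otimes> inv a) \<otimes> g \<in> A \<inter> H"
      by (rule normalizes_inv[OF normalizes_Int subgroup_AH g(1) B.m_inv_closed[OF g(2)]])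
    moreover have "inv g \<otimes> inv (g \<otimes> a \<otimes> inv g \<otimes> inv a) \<otimes> g = inv g \<otimes> a \<otimes> inv (inv g) \<otimes> inv a"
      using AH.mem_carrier[OF g(1)] assms by (simp add: word_simps)
    ultimately show ?thesis using AH.m_inv_closed[OF g(1)] by (simp only: conj_stabilizer_def mem_Collect_eq)
  qed
  show "g \<otimes> k \<in> conj_stabilizer a" if "g \<in> conj_stabilizer a" "k \<in> conj_stabilizer a" for g k
  proof -
    have g: "g \<in> A <#> H" "g \<otimes> a \<otimes> inv g \<otimes> inv a \<in> A \<inter> H"
      and k: "k \<in> A <#> H" "k \<otimes> a \<otimes> inv k \<otimes> inv a \<in> A \<inter> H"
      using that by (simp_all only: conj_stabilizer_def mem_Collect_eq)
    have "g \<otimes> (k \<otimes> a \<otimes> inv k \<otimes> inv a) \<otimes> inv g \<in> A \<inter> H"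
      using normalizes_Int g(1) k(2) unfolding normalizes_def by blast
    then have "g \<otimes> (k \<otimes> a \<otimes> inv k \<otimes> inv a) \<otimes> inv g \<otimes> (g \<otimes> a \<otimes> inv g \<otimes> inv a) \<in> A \<inter> H"
      using g(2) by (rule B.m_closed)
    moreover have "g \<otimes> (k \<otimes> a \<otimes> inv k \<otimes> inv a) \<otimes> inv g \<otimes> (g \<otimes> a \<otimes> inv g \<otimes> inv a)
       = g \<otimes> k \<otimes> a \<otimes> inv (g \<otimes> k) \<otimes> inv a"
      using AH.mem_carrier[OF g(1)] AH.mem_carrier[OF k(1)] assms by (simp add: word_simps)
    ultimately show ?thesis using AH.m_closed[OF g(1) k(1)] by (simp only: conj_stabilizer_def mem_Collect_eq)
  qed
qed

text \<open>Up to \<open>A\<close>, which acts trivially by conjugation on \<open>A/(A \<inter> H)\<close>, each element of \<open>A H\<close> may be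
  replaced by one of \<open>H\<close>; and \<open>y \<in> H\<close> sends the class of \<open>c \<in> A\<close> under conjugation to the point
  \<open>y c H\<close> of \<open>G/H\<close>.\<close>

lemma subquadratic_conj_stabilizer:
  assumes \<Gamma>: "subgroup \<Gamma> G" "A \<subseteq> \<Gamma>" "H \<subseteq> \<Gamma>" and sq: "subquadratic G \<Gamma> H" and a: "a \<in> A"
  shows "subquadratic G (A <#> H) (conj_stabilizer a)"
  unfolding subquadratic_def
proof (intro allI impI)
  interpret AH: subgroup "A <#> H" G by (rule subgroup_AH)
  interpret B: subgroup "A \<inter> H" G by (rule subgroup_Int)
  fix F C assume F: "finite F" "F \<subseteq> A <#> H"
  have "\<exists>k\<in>H. s \<otimes> inv k \<in> A" if "s \<in> F" for s
  proof -
    have "s \<in> A <#> H" by (rule subsetD[OF F(2) that])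
    then obtain b k where "b \<in> A" "k \<in> H" "s = b \<otimes> k" by (auto simp: set_mult_def)
    then show ?thesis by (intro bexI[of _ k]) (simp_all add: m_assoc)
  qed
  then obtain \<eta> where \<eta>: "\<And>s. s \<in> F \<Longrightarrow> \<eta> s \<in> H" "\<And>s. s \<in> F \<Longrightarrow> s \<otimes> inv (\<eta> s) \<in> A"
    by metis
  have F': "finite (\<eta> ` F)" "\<eta> ` F \<subseteq> \<Gamma>" "\<eta> ` F \<subseteq> H" using F(1) \<eta>(1) \<Gamma>(3) by auto
  obtain n where n: "n \<ge> C" "\<And>g. g \<in> \<Gamma> \<Longrightarrow>
      C * card ((\<lambda>x. (x \<otimes> g) <# H) ` set_power G (\<eta> ` F) n) \<le> n * n"
    using sq[unfolded subquadratic_def, rule_format, OF F'(1,2), of C] by auto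
  \<comment> \<open>Replacing each letter s by \<eta> s changes a word only by a left factor in A,
    since A H normalizes A.\<close>
  have lift: "\<exists>y\<in>set_power G (\<eta> ` F) n. x \<otimes> inv y \<in> A" if "x \<in> set_power G F n" for x n
    using that
  proof (induction n arbitrary: x)
    case (Suc n)
    then obtain s z where s: "s \<in> F" "z \<in> set_power G F n" "x = s \<otimes> z" by (auto simp: set_mult_def)
    then obtain y where y: "y \<in> set_power G (\<eta> ` F) n" "z \<otimes> inv y \<in> A" using Suc.IH by blast
    have yH: "y \<in> H" by (rule subsetD[OF set_power_subset[OF H F'(3)] y(1)])
    have zG: "z \<in> carrier G" by (rule AH.mem_carrier[OF subsetD[OF set_power_subset[OF subgroup_AH F(2)] s(2)]])
    have sAH: "s \<in> A <#> H" by (rule subsetD[OF F(2) s(1)])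
    have "s \<otimes> (z \<otimes> inv y) \<otimes> inv s \<in> A" by (rule conj_mem_A[OF sAH y(2)])
    then have "s \<otimes> (z \<otimes> inv y) \<otimes> inv s \<otimes> (s \<otimes> inv (\<eta> s)) \<in> A" using \<eta>(2)[OF s(1)] by (rule A.m_closed)
    then have "x \<otimes> inv (\<eta> s \<otimes> y) \<in> A"
      using s(3) AH.mem_carrier[OF sAH] zG yH \<eta>(1)[OF s(1)] by (simp add: word_simps)
    moreover have "\<eta> s \<otimes> y \<in> set_power G (\<eta> ` F) (Suc n)"
      unfolding set_power.simps set_mult_def using s(1) y(1) by blast
    ultimately show ?case by blast
  qed simp
  have "\<forall>x\<in>set_power G F n. \<exists>y. y \<in> set_power G (\<eta> ` F) n \<and> x \<otimes> inv y \<in> A"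
    using lift by blast
  from bchoice[OF this] obtain \<phi> where \<phi>:
    "\<And>x. x \<in> set_power G F n \<Longrightarrow> \<phi> x \<in> set_power G (\<eta> ` F) n"
    "\<And>x. x \<in> set_power G F n \<Longrightarrow> x \<otimes> inv (\<phi> x) \<in> A"
    by auto
  have "C * card ((\<lambda>x. (x \<otimes> g) <# conj_stabilizer a) ` set_power G F n) \<le> n * n"
    if g: "g \<in> A <#> H" for g
  proof -
    have gG: "g \<in> carrier G" by (rule AH.mem_carrier[OF g])
    \<comment> \<open>The hypothesis is applied at the base point c H, which varies with
      \<open>g\<close>. Here the uniformity of \<open>subquadratic\<close> in the base point is
      essential.\<close>
    define c where "c = g \<otimes> a \<otimes> inv g"
    have c: "c \<in> A" unfolding c_def by (rule conj_mem_A[OF g a])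
    let ?f = "\<lambda>y. (y \<otimes> c) <# H"
    have "card ((\<lambda>x. (x \<otimes> g) <# conj_stabilizer a) ` set_power G F n)
        \<le> card ((\<lambda>x. ?f (\<phi> x)) ` set_power G F n)"
    proof (rule card_image_factor)
      fix x x' assume x: "x \<in> set_power G F n" "x' \<in> set_power G F n" and e: "?f (\<phi> x) = ?f (\<phi> x')"
      have xAH: "x \<in> A <#> H" "x' \<in> A <#> H"
        using subsetD[OF set_power_subset[OF subgroup_AH F(2)]] x by blast+
      have xG: "x \<in> carrier G" "x' \<in> carrier G" using xAH AH.mem_carrier by blast+
      have yH: "\<phi> x \<in> H" "\<phi> x' \<in> H"
        using subsetD[OF set_power_subset[OF H F'(3)]] \<phi>(1) x by blast+
      define u u' where "u = \<phi> x \<otimes> c \<otimes> inv (\<phi> x)" and "u' = \<phi> x' \<otimes> c \<otimes> inv (\<phi> x')"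
      have u: "u \<in> A" "u' \<in> A"
        unfolding u_def u'_def using conj_mem_A[OF subsetD[OF H_subset] c] yH by blast+
      have conj: "(z \<otimes> c \<otimes> inv z) <# H = (y \<otimes> c \<otimes> inv y) <# H"
        if "z \<in> carrier G" "y \<in> H" "z \<otimes> inv y \<in> A" for z y
      proof -
        define b where "b = z \<otimes> inv y"
        have b: "b \<in> A" using that(3) by (simp add: b_def)
        have v: "y \<otimes> c \<otimes> inv y \<in> A" by (rule conj_mem_A[OF subsetD[OF H_subset that(2)] c])
        have "z \<otimes> c \<otimes> inv z = b \<otimes> (y \<otimes> c \<otimes> inv y) \<otimes> inv b"
          using that c by (simp add: b_def word_simps)
        also have "\<dots> <# H = (inv b \<otimes> (b \<otimes> (y \<otimes> c \<otimes> inv y))) <# H"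
          using b v by (intro coset_commute) simp_all
        also have "inv b \<otimes> (b \<otimes> (y \<otimes> c \<otimes> inv y)) = y \<otimes> c \<otimes> inv y"
          by (rule cancel_inv(1)) (use b v in simp_all)
        finally show ?thesis .
      qed
      have "inv (\<phi> x \<otimes> c) \<otimes> (\<phi> x' \<otimes> c) \<in> H"
        using e l_coset_eq_iff[OF H, of "\<phi> x \<otimes> c" "\<phi> x' \<otimes> c"] yH c by simp
      then have "\<phi> x \<otimes> (inv (\<phi> x \<otimes> c) \<otimes> (\<phi> x' \<otimes> c)) \<otimes> inv (\<phi> x') \<in> H"
        by (rule H.m_closed[OF H.m_closed[OF yH(1)] H.m_inv_closed[OF yH(2)]])
      then have "inv u \<otimes> u' \<in> H"
        using yH c by (simp add: u_def u'_def word_simps)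
      then have "u <# H = u' <# H" using l_coset_eq_iff[OF H, of u u'] u by simp
      then have "(x \<otimes> c \<otimes> inv x) <# H = (x' \<otimes> c \<otimes> inv x') <# H"
        using conj[OF xG(1) yH(1) \<phi>(2)[OF x(1)]] conj[OF xG(2) yH(2) \<phi>(2)[OF x(2)]]
        unfolding u_def u'_def by simp
      then have "inv (x \<otimes> c \<otimes> inv x) \<otimes> (x' \<otimes> c \<otimes> inv x') \<in> H"
        using l_coset_eq_iff[OF H, of "x \<otimes> c \<otimes> inv x" "x' \<otimes> c \<otimes> inv x'"] xG c by simp
      moreover have "inv (x \<otimes> c \<otimes> inv x) \<otimes> (x' \<otimes> c \<otimes> inv x') \<in> A"
        by (rule A.m_closed[OF A.m_inv_closed[OF conj_mem_A[OF xAH(1) c]] conj_mem_A[OF xAH(2) c]])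
      ultimately have w: "inv (x \<otimes> c \<otimes> inv x) \<otimes> (x' \<otimes> c \<otimes> inv x') \<in> A \<inter> H" by blast
      define k where "k = inv (x \<otimes> g) \<otimes> (x' \<otimes> g)"
      have xg: "x \<otimes> g \<in> A <#> H" "x' \<otimes> g \<in> A <#> H" using xAH g by simp_all
      have k: "k \<in> A <#> H" unfolding k_def by (rule AH.m_closed[OF AH.m_inv_closed[OF xg(1)] xg(2)])
      have "inv (x \<otimes> g) \<otimes> (inv (x \<otimes> c \<otimes> inv x) \<otimes> (x' \<otimes> c \<otimes> inv x')) \<otimes> (x \<otimes> g) \<in> A \<inter> H"
        by (rule normalizes_inv[OF normalizes_Int subgroup_AH xg(1) w])
      then have "a \<otimes> (inv (x \<otimes> g) \<otimes> (inv (x \<otimes> c \<otimes> inv x) \<otimes> (x' \<otimes> c \<otimes> inv x')) \<otimes> (x \<otimes> g)) \<otimes> inv a \<in> A \<inter> H"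
        using normalizes_Int subsetD[OF A_subset a] unfolding normalizes_def by blast
      also have "a \<otimes> (inv (x \<otimes> g) \<otimes> (inv (x \<otimes> c \<otimes> inv x) \<otimes> (x' \<otimes> c \<otimes> inv x')) \<otimes> (x \<otimes> g)) \<otimes> inv a
          = k \<otimes> a \<otimes> inv k \<otimes> inv a"
        unfolding c_def k_def using xG gG a by (simp add: word_simps)
      finally have "k \<in> conj_stabilizer a" using k by (simp only: conj_stabilizer_def mem_Collect_eq)
      then show "(x \<otimes> g) <# conj_stabilizer a = (x' \<otimes> g) <# conj_stabilizer a"
        using l_coset_eq_iff[OF subgroup_conj_stabilizer[OF a], of "x \<otimes> g" "x' \<otimes> g"] xG gG
        by (simp add: k_def)
    qed (rule finite_imageI[OF finite_set_power[OF F(1)]])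
    also have "\<dots> \<le> card (?f ` set_power G (\<eta> ` F) n)"
      using \<phi>(1) by (intro card_mono finite_imageI finite_set_power[OF F'(1)]) auto
    finally have "C * card ((\<lambda>x. (x \<otimes> g) <# conj_stabilizer a) ` set_power G F n)
        \<le> C * card (?f ` set_power G (\<eta> ` F) n)" by (rule mult_le_mono2)
    also have "\<dots> \<le> n * n" by (rule n(2)[OF subsetD[OF \<Gamma>(2) c]])
    finally show ?thesis .
  qed
  then show "\<exists>n\<ge>C. \<forall>g\<in>A <#> H. C * card ((\<lambda>x. (x \<otimes> g) <# conj_stabilizer a) ` set_power G F n) \<le> n * n"
    using n(1) by blast
qed


end

section \<open>The cyclic module generated by an aperiodic point\<close>

locale affine_orbit = abelian_orbit +
  fixes h a :: 'a
  assumes h_mem: "h \<in> H" and a_mem: "a \<in> A"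
    and no_period: "m > 0 \<Longrightarrow> h [^] (m::nat) \<otimes> a \<otimes> inv (h [^] m) \<otimes> inv a \<notin> H"
begin

definition cj :: "'a \<Rightarrow> 'a" where "cj y = h \<otimes> y \<otimes> inv h"

text \<open>\<open>ev p\<close> is the value at \<open>p\<close> of the map \<open>\<int>[x] \<rightarrow> A/(A \<inter> H)\<close> of \<open>\<int>[x]\<close>-modules that sends \<open>1\<close> to
  \<open>a\<close>, where \<open>x\<close> acts as conjugation by \<open>h\<close>.\<close>

definition ev :: "int poly \<Rightarrow> 'a" where
  "ev p = fold_coeffs (\<lambda>c y. a [^] c \<otimes> cj y) p \<one>"

lemma h_carrier [simp]: "h \<in> carrier G" using h_mem by simp
lemma a_carrier [simp]: "a \<in> carrier G" using a_mem by simp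

lemma cj_closed [simp]: "y \<in> A \<Longrightarrow> cj y \<in> A"
  using norm h_mem unfolding normalizes_def cj_def by blast

lemma a_pow_closed [simp]: "a [^] (k::int) \<in> A"
  by (rule subgroup_int_pow_closed[OF A a_mem])

lemma ev_0 [simp]: "ev 0 = \<one>"
  by (simp add: ev_def)

lemma ev_pCons: "ev (pCons c p) = a [^] c \<otimes> cj (ev p)"
  by (cases "p = 0 \<and> c = 0") (auto simp: ev_def cj_def)

lemma ev_closed [simp]: "ev p \<in> A"
  by (induction p) (auto simp: ev_pCons)

lemma ev_carrier [simp]: "ev p \<in> carrier G"
  by (rule A.mem_carrier) simp

lemma coset_cj_iff:
  assumes "x \<in> A" "y \<in> A"
  shows "cj x <# H = cj y <# H \<longleftrightarrow> x <# H = y <# H"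
proof -
  have e: "inv (cj x) \<otimes> cj y = h \<otimes> (inv x \<otimes> y) \<otimes> inv h"
    using assms by (simp add: cj_def word_simps)
  have "h \<otimes> (inv x \<otimes> y) \<otimes> inv h \<in> H \<longleftrightarrow> inv x \<otimes> y \<in> H"
  proof
    assume "h \<otimes> (inv x \<otimes> y) \<otimes> inv h \<in> H"
    then have "inv h \<otimes> (h \<otimes> (inv x \<otimes> y) \<otimes> inv h) \<otimes> h \<in> H" using h_mem by simp
    then show "inv x \<otimes> y \<in> H" using assms by (simp add: word_simps)
  qed (use h_mem in simp)
  then show ?thesis
    using l_coset_eq_iff[OF H, of "cj x" "cj y"] l_coset_eq_iff[OF H, of x y] assms
    by (simp add: e)
qed

lemma cj_mult: "x \<in> A \<Longrightarrow> y \<in> A \<Longrightarrow> cj (x \<otimes> y) = cj x \<otimes> cj y"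
  by (simp add: cj_def word_simps)

text \<open>A is abelian only modulo H, so \<open>ev\<close> is additive only up to cosets of
  H.\<close>

lemma ev_add: "ev (p + q) <# H = (ev p \<otimes> ev q) <# H"
proof (induction p q rule: poly_induct2)
  case (pCons c p d q)
  have "ev (pCons c p + pCons d q) <# H = (a [^] (c + d) \<otimes> cj (ev (p + q))) <# H"
    by (simp add: ev_pCons)
  also have "\<dots> = (a [^] c \<otimes> a [^] d \<otimes> (cj (ev p) \<otimes> cj (ev q))) <# H"
    using pCons coset_cj_iff[of "ev (p + q)" "ev p \<otimes> ev q"]
    by (intro coset_mult_cong) (simp_all add: int_pow_mult cj_mult)
  also have "a [^] c \<otimes> a [^] d \<otimes> (cj (ev p) \<otimes> cj (ev q)) = a [^] c \<otimes> ((a [^] d \<otimes> cj (ev p)) \<otimes> cj (ev q))"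
    by (simp add: m_assoc)
  also have "\<dots> <# H = (a [^] c \<otimes> ((cj (ev p) \<otimes> a [^] d) \<otimes> cj (ev q))) <# H"
    by (intro coset_mult_cong coset_commute refl) simp_all
  also have "a [^] c \<otimes> ((cj (ev p) \<otimes> a [^] d) \<otimes> cj (ev q)) = ev (pCons c p) \<otimes> ev (pCons d q)"
    by (simp add: ev_pCons m_assoc)
  finally show ?case .
qed simp

definition I :: "int poly set" where "I = {p. ev p \<in> H}"

lemma I_iff: "p \<in> I \<longleftrightarrow> ev p <# H = \<one> <# H"
  unfolding I_def using one_l_coset_eq_iff[OF H, of "ev p"] by simp

lemma diff_mem_I_iff: "p - q \<in> I \<longleftrightarrow> ev p <# H = ev q <# H"
proof -
  have "ev p <# H = (ev q \<otimes> ev (p - q)) <# H" using ev_add[of q "p - q"] by simp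
  then have "ev p <# H = ev q <# H \<longleftrightarrow> (ev q \<otimes> ev (p - q)) <# H = ev q <# H" by simp
  also have "\<dots> \<longleftrightarrow> p - q \<in> I"
    using l_coset_eq_iff[OF H, of "ev q" "ev q \<otimes> ev (p - q)"] by (auto simp: I_def)
  finally show ?thesis by simp
qed

lemma I_add: "p \<in> I \<Longrightarrow> q \<in> I \<Longrightarrow> p + q \<in> I"
  unfolding I_iff using ev_add[of p q] coset_mult_cong[of "ev p" \<one> "ev q" \<one>] by simp

lemma I_uminus: "p \<in> I \<Longrightarrow> - p \<in> I"
  using diff_mem_I_iff[of 0 p] by (simp add: I_iff)

lemma I_X_iff: "pCons 0 p \<in> I \<longleftrightarrow> p \<in> I"
proof -
  have "cj \<one> = \<one>" by (simp add: cj_def)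
  then show ?thesis unfolding I_iff using coset_cj_iff[of "ev p" \<one>] by (simp add: ev_pCons)
qed

lemma I_smult: "p \<in> I \<Longrightarrow> smult c p \<in> I"
proof -
  assume p: "p \<in> I"
  have n: "smult (int n) p \<in> I" for n
    by (induction n) (simp_all add: I_iff[of 0] smult_add_left I_add p)
  show "smult c p \<in> I"
    using n[of "nat c"] I_uminus[OF n[of "nat (- c)"]] by (cases "c \<ge> 0") simp_all
qed

lemma ev_monom: "ev (of_nat c * [:0, 1:] ^ n) = h [^] n \<otimes> a [^] c \<otimes> inv (h [^] n)"
proof (induction n)
  case 0
  have "of_nat c * [:0, 1:] ^ 0 = [:int c:]" by (simp add: of_nat_poly)
  then show ?case by (simp add: ev_pCons cj_def int_pow_int)
next
  case (Suc n)
  have "of_nat c * [:0, 1:] ^ Suc n = pCons 0 (of_nat c * [:0, 1:] ^ n :: int poly)" by simp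
  then have "ev (of_nat c * [:0, 1:] ^ Suc n) = cj (ev (of_nat c * [:0, 1:] ^ n))"
    using A.mem_carrier[OF cj_closed[OF ev_closed]] by (simp only: ev_pCons) simp
  also have "\<dots> = h [^] Suc n \<otimes> a [^] c \<otimes> inv (h [^] Suc n)"
    unfolding Suc cj_def nat_pow_Suc2[OF h_carrier] by (simp add: word_simps)
  finally show ?case .
qed

sublocale aperiodic_ideal I
proof
  show "0 \<in> I" by (simp add: I_iff)
  show "p + q \<in> I" if "p \<in> I" "q \<in> I" for p q using that by (rule I_add)
  show "r * p \<in> I" if "p \<in> I" for p r
    using that
  proof (induction r)
    case (pCons c r)
    then show ?case by (auto simp: I_X_iff intro!: I_add I_smult)
  qed (simp add: I_iff)
  show "p \<in> I" if "[:0, 1:] * p \<in> I" for p using that by (simp add: I_X_iff)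
  show "[:0, 1:] ^ e - 1 \<notin> I" if "e > 0" for e
  proof
    let ?b = "h [^] e \<otimes> a \<otimes> inv (h [^] e)"
    assume *: "[:0, 1:] ^ e - 1 \<in> I"
    have eq: "ev ([:0, 1:] ^ e) = ?b" "ev 1 = a"
      using ev_monom[of 1 e] ev_monom[of 1 0] by simp_all
    have b: "?b \<in> A" using ev_closed[of "[:0, 1:] ^ e"] unfolding eq .
    have "?b <# H = a <# H" using * unfolding diff_mem_I_iff eq .
    then have "(?b \<otimes> inv a) <# H = (a \<otimes> inv a) <# H"
      by (intro coset_mult_cong) (use b a_mem in simp_all)
    then have "?b \<otimes> inv a \<in> H" using one_l_coset_eq_iff[OF H, of "?b \<otimes> inv a"] by simp
    then show False using no_period[OF that] by simp
  qed
qed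

text \<open>On the cosets c H with c in A, left multiplication by h is multiplication by X, because
  h c H = (h c h^-1) H; left multiplication by an element of A is a translation. So short words in h
  and elements of A reach the values of many polynomials.\<close>

lemma not_subquadratic:
  assumes \<Gamma>: "subgroup \<Gamma> G" "A \<subseteq> \<Gamma>" "H \<subseteq> \<Gamma>" and sq: "subquadratic G \<Gamma> H"
  shows False
  using subset_sum_free_or_grid_free
proof (elim disjE exE)
  fix w assume w: "subset_sum_free w"
  define F where "F = {\<one>, h, ev w}"
  have F: "finite F" "F \<subseteq> \<Gamma>" "\<one> \<in> F" "F \<subseteq> carrier G" "h \<in> F" "ev w \<in> F"
    using \<Gamma> h_mem subgroup.one_closed[OF \<Gamma>(1)] ev_closed[of w] by (auto simp: F_def)
  \<comment> \<open>Horner's scheme: each exponent costs two letters, h for the multiplication by X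
    and then \<open>ev w\<close> or the identity, according to whether 0 is in J.\<close>
  have reach: "\<exists>g\<in>set_power G F (2 * n). g <# H = ev (\<Sum>i\<in>J. X ^ i * w) <# H" if "J \<subseteq> {..<n}" for n J
    using that
  proof (induction n arbitrary: J)
    case (Suc n)
    define J' where "J' = {i. Suc i \<in> J}"
    define P where "P = (\<Sum>i\<in>J'. X ^ i * w)"
    have J': "J' \<subseteq> {..<n}" using Suc.prems by (auto simp: J'_def)
    then obtain g where g: "g \<in> set_power G F (2 * n)" "g <# H = ev P <# H"
      unfolding P_def using Suc.IH by blast
    have gc: "g \<in> carrier G" using g(1) set_power_subset[OF subgroup_self F(4)] by blast
    define z where "z = (if 0 \<in> J then w else 0)"
    have z: "ev z \<in> F" using F by (simp add: z_def)
    have "finite J'" using J' finite_subset by blast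
    moreover have "J = (if 0 \<in> J then {0} else {}) \<union> Suc ` J'"
      by (auto simp: J'_def image_iff gr0_conv_Suc) (metis not0_implies_Suc)+
    ultimately have "(\<Sum>i\<in>J. X ^ i * w) = z + (\<Sum>i\<in>J'. X ^ Suc i * w)"
      by (subst \<open>J = _\<close>, subst sum.union_disjoint) (auto simp: sum.reindex z_def)
    also have "(\<Sum>i\<in>J'. X ^ Suc i * w) = X * P"
      by (simp only: P_def sum_distrib_left power_Suc mult.assoc)
    also have "X * P = pCons 0 P" by simp
    finally have sum: "(\<Sum>i\<in>J. X ^ i * w) = z + pCons 0 P" .
    have "(ev z \<otimes> (h \<otimes> g)) <# H = (ev z \<otimes> (h \<otimes> ev P)) <# H"
      using gc by (intro l_coset_mult_left_cong[OF H] g(2)) simp_all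
    also have "(ev z \<otimes> (h \<otimes> ev P)) = (ev z \<otimes> ev (pCons 0 P)) \<otimes> h"
      by (simp add: ev_pCons cj_def word_simps)
    also have "\<dots> <# H = ev (z + pCons 0 P) <# H"
      using ev_add[of z "pCons 0 P"] h_mem by (simp add: l_coset_mult_right[OF H])
    finally have "(ev z \<otimes> (h \<otimes> g)) <# H = ev (\<Sum>i\<in>J. X ^ i * w) <# H" unfolding sum .
    moreover have "ev z \<otimes> (h \<otimes> g) \<in> set_power G F (2 * Suc n)"
      using z F(5) g(1) by (auto simp: set_mult_def)
    ultimately show ?case by blast
  qed simp
  \<comment> \<open>The subsets of 2 p exponents cost 4 p letters each, and there are 2^(2 p) = 2^p
    2^p \<ge> p^2 of them.\<close>
  obtain p where p0: "p > 0"
    "\<And>g. g \<in> \<Gamma> \<Longrightarrow> card ((\<lambda>x. (x \<otimes> g) <# H) ` set_power G F (4 * p)) < p * p"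
    using subquadratic_bound[OF sq F(1-3), of 4] subgroup.subset[OF \<Gamma>(1)] by auto
  note p = p0(1) p0(2)[OF subgroup.one_closed[OF \<Gamma>(1)]]
  let ?f = "\<lambda>J. ev (\<Sum>i\<in>J. X ^ i * w) <# H"
  have "inj_on ?f (Pow {..<2 * p})"
    using w unfolding subset_sum_free_def diff_mem_I_iff
    by (intro inj_onI) (meson PowD finite_lessThan finite_subset)
  moreover have "?f ` Pow {..<2 * p} \<subseteq> (\<lambda>x. (x \<otimes> \<one>) <# H) ` set_power G F (4 * p)"
  proof (rule image_subsetI)
    fix J assume "J \<in> Pow {..<2 * p}"
    then obtain g where g: "g \<in> set_power G F (2 * (2 * p))" "g <# H = ?f J" using reach by blast
    have "g \<in> carrier G" by (rule subsetD[OF set_power_subset[OF subgroup_self F(4)] g(1)])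
    then have "?f J = (g \<otimes> \<one>) <# H" unfolding g(2)[symmetric] by simp
    moreover have "2 * (2 * p) = 4 * p" by simp
    then have "g \<in> set_power G F (4 * p)" using g(1) by simp
    ultimately show "?f J \<in> (\<lambda>x. (x \<otimes> \<one>) <# H) ` set_power G F (4 * p)" by (rule image_eqI)
  qed
  ultimately have "card (Pow {..<2 * p}) \<le> card ((\<lambda>x. (x \<otimes> \<one>) <# H) ` set_power G F (4 * p))"
    by (rule card_inj_on_le) (rule finite_imageI[OF finite_set_power[OF F(1)]])
  then have "2 ^ (2 * p) < p * p" using p(2) by (simp only: card_Pow finite_lessThan card_lessThan)
  moreover have "p * p \<le> 2 ^ (2 * p)"
    using mult_le_mono[OF less_imp_le[OF less_exp] less_imp_le[OF less_exp], of p p]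
    by (simp add: mult_2 power_add)
  ultimately show False by simp
next
  fix m k assume mk: "grid_free m k"
  define F where "F = {\<one>, h [^] m, a [^] k, a}"
  have "h [^] m \<in> \<Gamma>" "a [^] k \<in> \<Gamma>"
    using \<Gamma>(2,3) h_mem a_mem subgroup_int_pow_closed[OF H h_mem, of "int m"] a_pow_closed[of "int k"]
    by (auto simp: int_pow_int)
  then have F: "finite F" "F \<subseteq> \<Gamma>" "\<one> \<in> F" "F \<subseteq> carrier G" "h [^] m \<in> F" "a [^] k \<in> F" "a \<in> F"
    using \<Gamma> a_mem subgroup.one_closed[OF \<Gamma>(1)] by (auto simp: F_def)
  obtain p where p0: "p > 0"
    "\<And>g. g \<in> \<Gamma> \<Longrightarrow> card ((\<lambda>x. (x \<otimes> g) <# H) ` set_power G F (3 * p)) < p * p"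
    using subquadratic_bound[OF sq F(1-3), of 3] subgroup.subset[OF \<Gamma>(1)] by auto
  note p = p0(1) p0(2)[OF subgroup.one_closed[OF \<Gamma>(1)]]
  let ?f = "\<lambda>(i, q). ev (of_nat (k * q + 1) * X ^ (m * i)) <# H"
  have "inj_on ?f ({..<p} \<times> {..<p})"
    using mk unfolding grid_free_def diff_mem_I_iff by (intro inj_onI) (auto simp del: of_nat_add of_nat_mult)
  moreover have "?f ` ({..<p} \<times> {..<p}) \<subseteq> (\<lambda>x. (x \<otimes> \<one>) <# H) ` set_power G F (3 * p)"
  proof (intro image_subsetI)
    fix iq assume "iq \<in> {..<p} \<times> {..<p}"
    then obtain i q where iq: "iq = (i, q)" "i < p" "q < p" by auto
    \<comment> \<open>The innermost letter \<open>a\<close> supplies the 1 in k q + 1. The factor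
      inverse to the power of h in \<open>ev_monom\<close> lies in H and disappears in the coset.
      The word is thus covered by p + (p + 1) \<le> 3 p letters.\<close>
    let ?g = "(h [^] m) [^] i \<otimes> ((a [^] k) [^] q \<otimes> a)"
    have "(h [^] m) [^] i \<in> H" by (metis H.m_inv_closed h_mem H subgroup_int_pow_closed int_pow_int)
    then have "?f iq = ?g <# H"
      unfolding iq case_prod_conv ev_monom
      using l_coset_mult_right[OF H, of ?g "inv ((h [^] m) [^] i)"]
      by (simp add: nat_pow_pow nat_pow_mult[symmetric])
    moreover have "?g \<in> set_power G F (p + (p + 1))"
      using iq(2,3) by (intro set_power_add[OF F(4)] set_power_pow[OF F(4)] set_power_one[OF F(4)] F) simp_all
    then have "?g \<in> set_power G F (3 * p)"
      using set_power_mono[OF F(3,4), of "p + (p + 1)" "3 * p"] p(1) by auto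
    ultimately show "?f iq \<in> (\<lambda>x. (x \<otimes> \<one>) <# H) ` set_power G F (3 * p)"
      by (intro image_eqI[of _ _ ?g]) simp_all
  qed
  ultimately have "card ({..<p} \<times> {..<p}) \<le> card ((\<lambda>x. (x \<otimes> \<one>) <# H) ` set_power G F (3 * p))"
    by (rule card_inj_on_le) (rule finite_imageI[OF finite_set_power[OF F(1)]])
  then show False using p(2) by (simp only: card_cartesian_product card_lessThan)
qed

end

section \<open>Solvable groups\<close>

context group
begin

lemma normalizes_derived:
  assumes "subgroup \<Gamma> G" "D \<subseteq> carrier G" "normalizes G \<Gamma> D"
  shows "normalizes G \<Gamma> (derived G D)"
  unfolding normalizes_def
proof (intro ballI)
  fix g x assume g: "g \<in> \<Gamma>" and "x \<in> derived G D"
  have gG: "g \<in> carrier G" by (rule subgroup.mem_carrier[OF assms(1) g])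
  have comm: "g \<otimes> u \<otimes> inv g \<in> derived G D" if u: "u \<in> derived_set G D" for u
  proof -
    obtain v w where vw: "v \<in> D" "w \<in> D" "u = v \<otimes> w \<otimes> inv v \<otimes> inv w" using u by blast
    have c: "v \<in> carrier G" "w \<in> carrier G" using vw(1,2) assms(2) by auto
    have "g \<otimes> v \<otimes> inv g \<in> D" "g \<otimes> w \<otimes> inv g \<in> D"
      using assms(3) g vw(1,2) unfolding normalizes_def by blast+
    note commutator_mem_derived[OF this]
    then show ?thesis using c gG by (simp add: vw(3) word_simps)
  qed
  have dc: "derived_set G D \<subseteq> carrier G" by (rule derived_set_in_carrier[OF assms(2)])
  interpret der: subgroup "derived G D" G by (rule derived_is_subgroup[OF assms(2)])
  from \<open>x \<in> derived G D\<close> have "x \<in> generate G (derived_set G D)" by (simp add: derived_def)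
  then show "g \<otimes> x \<otimes> inv g \<in> derived G D"
  proof induction
    case one
    then show ?case using gG by simp
  next
    case (incl u)
    then show ?case by (rule comm)
  next
    case (inv u)
    have "inv (g \<otimes> u \<otimes> inv g) \<in> derived G D" by (rule der.m_inv_closed[OF comm[OF inv]])
    moreover have "u \<in> carrier G" by (rule subsetD[OF dc inv])
    ultimately show ?case using gG by (simp add: word_simps)
  next
    case (eng u v)
    have "(g \<otimes> u \<otimes> inv g) \<otimes> (g \<otimes> v \<otimes> inv g) \<in> derived G D" by (rule der.m_closed[OF eng(3,4)])
    moreover have "u \<in> carrier G" "v \<in> carrier G" using eng(1,2) generate_in_carrier[OF dc] by blast+
    ultimately show ?case using gG by (simp add: word_simps)
  qed
qed

lemma normalizes_exp_of_derived:
  assumes "subgroup \<Gamma> G"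
  shows "normalizes G \<Gamma> ((derived G ^^ n) \<Gamma>)"
proof (induction n)
  case 0
  then show ?case
    using assms by (simp add: normalizes_def subgroup.m_closed subgroup.m_inv_closed)
next
  case (Suc n)
  then show ?case
    using normalizes_derived[OF assms exp_of_derived_in_carrier[OF subgroup.subset[OF assms]]] by simp
qed

lemma finite_index_INT:
  assumes "subgroup \<Gamma> G" "finite T" "\<And>t. t \<in> T \<Longrightarrow> subgroup (f t) G \<and> finite_index G \<Gamma> (f t)"
  shows "subgroup (\<Gamma> \<inter> (\<Inter>t\<in>T. f t)) G \<and> finite_index G \<Gamma> (\<Gamma> \<inter> (\<Inter>t\<in>T. f t))"
  using assms(2,3)
proof induction
  case empty
  have "x <# \<Gamma> = \<one> <# \<Gamma>" if "x \<in> \<Gamma>" for x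
    using one_l_coset_eq_iff[OF assms(1)] subgroup.mem_carrier[OF assms(1)] that by blast
  then have "(\<lambda>x. x <# \<Gamma>) ` \<Gamma> \<subseteq> {\<one> <# \<Gamma>}" by blast
  then show ?case using assms(1) finite_subset unfolding finite_index_def by auto
next
  case (insert t T)
  have eq: "\<Gamma> \<inter> (\<Inter>t\<in>insert t T. f t) = f t \<inter> (\<Gamma> \<inter> (\<Inter>t\<in>T. f t))" by blast
  have IH: "subgroup (\<Gamma> \<inter> (\<Inter>t\<in>T. f t)) G" "finite_index G \<Gamma> (\<Gamma> \<inter> (\<Inter>t\<in>T. f t))"
    using insert.IH insert.prems by simp_all
  have ft: "subgroup (f t) G" "finite_index G \<Gamma> (f t)" using insert.prems by simp_all
  show ?case unfolding eq
    using subgroups_Inter_pair[OF ft(1) IH(1)]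
      finite_index_Int[OF ft(2) IH(2) ft(1) IH(1) subgroup.subset[OF assms(1)]] by (rule conjI)
qed

end

section \<open>Periodicity and virtual triviality of the linear part\<close>

context abelian_orbit
begin

text \<open>Write t = b h with b in A and h in H. As A acts trivially by conjugation on A/(A Int H),
  the powers t^m and h^m act alike there. If none of them fixed the class of a, then h and a would
  satisfy \<open>affine_orbit\<close>, whose growth is too large.\<close>

lemma conj_stabilizer_periodic:
  assumes \<Gamma>: "subgroup \<Gamma> G" "A \<subseteq> \<Gamma>" "H \<subseteq> \<Gamma>" and sq: "subquadratic G \<Gamma> H"
    and a: "a \<in> A" and t: "t \<in> A <#> H"
  shows "\<exists>m>0. t [^] (m::nat) \<in> conj_stabilizer a"
proof (rule ccontr)
  assume none: "\<not> ?thesis"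
  interpret St: subgroup "conj_stabilizer a" G by (rule subgroup_conj_stabilizer[OF a])
  interpret AH: subgroup "A <#> H" G by (rule subgroup_AH)
  obtain b h where h: "b \<in> A" "h \<in> H" "t = b \<otimes> h" using t by (auto simp: set_mult_def)
  have hp: "h [^] m \<in> H" for m :: nat using h(2) by (induction m) simp_all
  have quot: "t [^] m \<otimes> inv (h [^] m) \<in> A" for m :: nat
  proof (induction m)
    case (Suc m)
    have tG: "t \<in> carrier G" by (rule AH.mem_carrier[OF t])
    have "t \<otimes> (t [^] m \<otimes> inv (h [^] m)) \<otimes> inv t \<in> A" by (rule conj_mem_A[OF t Suc])
    then have "t \<otimes> (t [^] m \<otimes> inv (h [^] m)) \<otimes> inv t \<otimes> b \<in> A" using h(1) by (rule A.m_closed)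
    moreover have "t \<otimes> (t [^] m \<otimes> inv (h [^] m)) \<otimes> inv t \<otimes> b = t [^] Suc m \<otimes> inv (h [^] Suc m)"
      unfolding nat_pow_Suc2[OF tG] nat_pow_Suc2[OF H.mem_carrier[OF h(2)]]
    proof -
      have "inv t \<otimes> b = inv h" using h by (simp add: word_simps)
      then show "t \<otimes> (t [^] m \<otimes> inv (h [^] m)) \<otimes> inv t \<otimes> b
          = t \<otimes> t [^] m \<otimes> inv (h \<otimes> h [^] m)"
        using tG h(1) H.mem_carrier[OF h(2)] by (simp add: word_simps)
    qed
    ultimately show ?case by simp
  qed simp
  have "h [^] m \<otimes> a \<otimes> inv (h [^] m) \<otimes> inv a \<notin> H" if "m > 0" for m :: nat
  proof
    assume *: "h [^] m \<otimes> a \<otimes> inv (h [^] m) \<otimes> inv a \<in> H"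
    have hm: "h [^] m \<in> A <#> H" by (rule subsetD[OF H_subset hp])
    have "h [^] m \<otimes> a \<otimes> inv (h [^] m) \<otimes> inv a \<in> A"
      by (rule A.m_closed[OF conj_mem_A[OF hm a] A.m_inv_closed[OF a]])
    then have "h [^] m \<in> conj_stabilizer a" using * hm by (simp add: conj_stabilizer_def)
    then have "t [^] m \<otimes> inv (h [^] m) \<otimes> h [^] m \<in> conj_stabilizer a"
      by (rule St.m_closed[OF subsetD[OF A_subset_conj_stabilizer[OF a] quot]])
    moreover have "t [^] m \<otimes> inv (h [^] m) \<otimes> h [^] m = t [^] m"
      using AH.mem_carrier[OF t] H.mem_carrier[OF h(2)] by (simp add: m_assoc)
    ultimately show False using none that by metis
  qed
  then interpret affine_orbit G A H h a
    by unfold_locales (use h(2) a in auto)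
  show False by (rule not_subquadratic[OF \<Gamma> sq])
qed

text \<open>\<open>N\<close> acts by translations on the cosets x H with x in A: if n = b h and k =
  c h' with b, c in A and h, h' in H, then n k H = n c H = (n c n^-1) b H = c b H. This is symmetric
  in n and k, so commutators fix the base point.\<close>

lemma derived_subset_of_trivial_conj:
  assumes "subgroup N G" "N \<subseteq> A <#> H" and triv: "\<And>n x. n \<in> N \<Longrightarrow> x \<in> A \<Longrightarrow> n \<otimes> x \<otimes> inv n \<otimes> inv x \<in> H"
  shows "derived G N \<subseteq> H"
  unfolding derived_def
proof (rule generate_subgroup_incl[OF _ H])
  interpret N: subgroup N G by (rule assms(1))
  have main: "inv (y \<otimes> x) \<otimes> (x \<otimes> y) \<in> H" if xy: "x \<in> N" "y \<in> N" for x y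
  proof -
    have coset: "(n \<otimes> k) <# H = (b \<otimes> c) <# H"
      if n: "n \<in> N" "k \<in> N" "b \<in> A" "h \<in> H" "n = b \<otimes> h" "c \<in> A" "h' \<in> H" "k = c \<otimes> h'" for n k b h c h'
    proof -
      have "(n \<otimes> k) <# H = (n \<otimes> c \<otimes> h') <# H" using n by (simp add: m_assoc)
      also have "\<dots> = (n \<otimes> c) <# H" using n by (intro l_coset_mult_right[OF H]) simp_all
      also have "n \<otimes> c = n \<otimes> c \<otimes> inv n \<otimes> b \<otimes> h" using n by (simp add: word_simps)
      also have "\<dots> <# H = (n \<otimes> c \<otimes> inv n \<otimes> b) <# H"
        using N.mem_carrier[OF n(1)] A.mem_carrier[OF n(3)] A.mem_carrier[OF n(6)] n(4)
        by (intro l_coset_mult_right[OF H]) simp_all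
      also have "\<dots> = (c \<otimes> b) <# H"
      proof (rule coset_mult_cong)
        show cA: "n \<otimes> c \<otimes> inv n \<in> A" by (rule conj_mem_A[OF subsetD[OF assms(2) n(1)] n(6)])
        show "(n \<otimes> c \<otimes> inv n) <# H = c <# H" by (rule coset_eqI[OF cA n(6) triv[OF n(1,6)]])
      qed (use n in simp_all)
      also have "\<dots> = (b \<otimes> c) <# H" using n by (intro coset_commute)
      finally show ?thesis .
    qed
    obtain b h where b: "b \<in> A" "h \<in> H" "x = b \<otimes> h"
      using subsetD[OF assms(2) xy(1)] by (auto simp: set_mult_def)
    obtain c k where c: "c \<in> A" "k \<in> H" "y = c \<otimes> k"
      using subsetD[OF assms(2) xy(2)] by (auto simp: set_mult_def)
    have "(y \<otimes> x) <# H = (c \<otimes> b) <# H" by (rule coset[OF xy(2,1) c b])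
    also have "\<dots> = (b \<otimes> c) <# H" by (rule coset_commute[OF c(1) b(1)])
    also have "\<dots> = (x \<otimes> y) <# H" by (rule coset[OF xy b c, symmetric])
    finally show ?thesis
      using l_coset_eq_iff[OF H, of "y \<otimes> x" "x \<otimes> y"] N.mem_carrier xy by simp
  qed
  show "derived_set G N \<subseteq> H"
  proof
    fix u assume "u \<in> derived_set G N"
    then obtain v w where vw: "v \<in> N" "w \<in> N" "u = v \<otimes> w \<otimes> inv v \<otimes> inv w" by blast
    have "inv (inv w \<otimes> inv v) \<otimes> (inv v \<otimes> inv w) \<in> H"
      by (rule main[OF N.m_inv_closed[OF vw(1)] N.m_inv_closed[OF vw(2)]])
    then show "u \<in> H" using N.mem_carrier[OF vw(1)] N.mem_carrier[OF vw(2)]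
      by (simp add: vw(3) word_simps)
  qed
qed

text \<open>A need not be finitely generated, so the stabilizers of generators of A cannot simply be
  intersected. Instead, \<open>N\<close> fixes the classes of the A-parts \<beta> s of the finitely
  many generators of A H. Since A H normalizes \<open>N\<close>, the elements of A whose class is
  fixed by \<open>N\<close> form a subgroup \<open>Z\<close> that H normalizes; so Z H is a group
  containing all generators, hence contains A H.\<close>

lemma virtually_trivial_conj:
  assumes fg: "finitely_generated G (A <#> H)"
    and fi: "\<And>a. a \<in> A \<Longrightarrow> finite_index G (A <#> H) (conj_stabilizer a)"
  obtains N where "subgroup N G" "N \<subseteq> A <#> H" "finite_index G (A <#> H) N" "derived G N \<subseteq> H"
proof -
  interpret AH: subgroup "A <#> H" G by (rule subgroup_AH)
  interpret B: subgroup "A \<inter> H" G by (rule subgroup_Int)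
  obtain S where S: "finite S" "S \<subseteq> carrier G" "A <#> H = generate G S"
    using fg unfolding finitely_generated_def by (elim exE conjE)
  have S_AH: "S \<subseteq> A <#> H" unfolding S(3) by (auto intro: generate.incl)
  have "\<forall>s\<in>S. \<exists>b. b \<in> A \<and> (\<exists>h\<in>H. s = b \<otimes> h)" using S_AH unfolding set_mult_def by blast
  from bchoice[OF this] obtain \<beta> where \<beta>: "\<forall>s\<in>S. \<beta> s \<in> A \<and> (\<exists>h\<in>H. s = \<beta> s \<otimes> h)" by blast
  define \<Lambda> where "\<Lambda> = (A <#> H) \<inter> (\<Inter>s\<in>S. conj_stabilizer (\<beta> s))"
  have "subgroup \<Lambda> G \<and> finite_index G (A <#> H) \<Lambda>"
    unfolding \<Lambda>_def
    by (rule finite_index_INT[OF subgroup_AH S(1)]) (use \<beta> fi subgroup_conj_stabilizer in simp)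
  then obtain N where N: "subgroup N G" "N \<subseteq> A <#> H" "N \<subseteq> \<Lambda>" "normalizes G (A <#> H) N"
    "finite_index G (A <#> H) N"
    using finite_index_core[OF _ subgroup_AH] by metis
  interpret N: subgroup N G by (rule N(1))
  define Z where "Z = {x \<in> A. \<forall>n\<in>N. n \<otimes> x \<otimes> inv n \<otimes> inv x \<in> A \<inter> H}"
  have ZA: "x \<in> A" if "x \<in> Z" for x using that by (simp add: Z_def)
  have ZD: "n \<otimes> x \<otimes> inv n \<otimes> inv x \<in> A \<inter> H" if "x \<in> Z" "n \<in> N" for x n
    using that by (simp add: Z_def)
  have normB: "g \<otimes> x \<otimes> inv g \<in> A \<inter> H" if "g \<in> A <#> H" "x \<in> A \<inter> H" for g x
    using normalizes_Int that unfolding normalizes_def by blast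
  have ZI: "x \<in> Z" if "x \<in> A" "\<And>n. n \<in> N \<Longrightarrow> n \<otimes> x \<otimes> inv n \<otimes> inv x \<in> A \<inter> H" for x
    using that by (simp add: Z_def)
  have subZ: "subgroup Z G"
  proof (rule subgroupI)
    show "Z \<subseteq> carrier G" using ZA A.subset by blast
    have "\<one> \<in> Z" by (rule ZI) (use N.mem_carrier in simp_all)
    then show "Z \<noteq> {}" by blast
    show "inv x \<in> Z" if x: "x \<in> Z" for x
    proof (rule ZI)
      show "inv x \<in> A" using ZA[OF x] by simp
      fix n assume n: "n \<in> N"
      have "inv x \<otimes> inv (n \<otimes> x \<otimes> inv n \<otimes> inv x) \<otimes> x \<in> A \<inter> H"
        by (rule normalizes_inv[OF normalizes_Int subgroup_AH subsetD[OF A_subset ZA[OF x]]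
              B.m_inv_closed[OF ZD[OF x n]]])
      then show "n \<otimes> inv x \<otimes> inv n \<otimes> inv (inv x) \<in> A \<inter> H"
        using N.mem_carrier[OF n] A.mem_carrier[OF ZA[OF x]] by (simp add: word_simps)
    qed
    show "x \<otimes> y \<in> Z" if xy: "x \<in> Z" "y \<in> Z" for x y
    proof (rule ZI)
      show "x \<otimes> y \<in> A" using ZA xy by simp
      fix n assume n: "n \<in> N"
      have "n \<otimes> x \<otimes> inv n \<otimes> inv x \<otimes> (x \<otimes> (n \<otimes> y \<otimes> inv n \<otimes> inv y) \<otimes> inv x) \<in> A \<inter> H"
        by (rule B.m_closed[OF ZD[OF xy(1) n] normB[OF subsetD[OF A_subset ZA[OF xy(1)]] ZD[OF xy(2) n]]])
      then show "n \<otimes> (x \<otimes> y) \<otimes> inv n \<otimes> inv (x \<otimes> y) \<in> A \<inter> H"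
        using N.mem_carrier[OF n] A.mem_carrier[OF ZA[OF xy(1)]] A.mem_carrier[OF ZA[OF xy(2)]]
        by (simp add: word_simps)
    qed
  qed
  interpret Z: subgroup Z G by (rule subZ)
  have normZ: "normalizes G H Z"
    unfolding normalizes_def
  proof (intro ballI)
    fix h x assume h: "h \<in> H" and x: "x \<in> Z"
    have hAH: "h \<in> A <#> H" by (rule subsetD[OF H_subset h])
    show "h \<otimes> x \<otimes> inv h \<in> Z"
    proof (rule ZI)
      show "h \<otimes> x \<otimes> inv h \<in> A" by (rule conj_mem_A[OF hAH ZA[OF x]])
      fix n assume n: "n \<in> N"
      have n': "inv h \<otimes> n \<otimes> h \<in> N" by (rule normalizes_inv[OF N(4) subgroup_AH hAH n])
      have "h \<otimes> ((inv h \<otimes> n \<otimes> h) \<otimes> x \<otimes> inv (inv h \<otimes> n \<otimes> h) \<otimes> inv x) \<otimes> inv h \<in> A \<inter> H"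
        by (rule normB[OF hAH ZD[OF x n']])
      then show "n \<otimes> (h \<otimes> x \<otimes> inv h) \<otimes> inv n \<otimes> inv (h \<otimes> x \<otimes> inv h) \<in> A \<inter> H"
        using N.mem_carrier[OF n] A.mem_carrier[OF ZA[OF x]] H.mem_carrier[OF h] by (simp add: word_simps)
    qed
  qed
  have "S \<subseteq> Z <#> H"
  proof
    fix s assume s: "s \<in> S"
    then obtain h where h: "\<beta> s \<in> A" "h \<in> H" "s = \<beta> s \<otimes> h" using \<beta> by blast
    have "\<beta> s \<in> Z"
    proof (rule ZI[OF h(1)])
      fix n assume "n \<in> N"
      then have "n \<in> conj_stabilizer (\<beta> s)" using N(3) s unfolding \<Lambda>_def by blast
      then show "n \<otimes> \<beta> s \<otimes> inv n \<otimes> inv \<beta> s \<in> A \<inter> H" by (simp add: conj_stabilizer_def)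
    qed
    then show "s \<in> Z <#> H" using h(2,3) unfolding set_mult_def by blast
  qed
  then have AH_ZH: "A <#> H \<subseteq> Z <#> H"
    unfolding S(3) by (rule generate_subgroup_incl[OF _ subgroup_set_mult_normalizes[OF subZ H normZ]])
  \<comment> \<open>A lies in Z H, and \<open>Z\<close> contains A Int H, so the factor from H may
    be absorbed.\<close>
  have AZ: "x \<in> Z" if x: "x \<in> A" for x
  proof -
    obtain z h where z: "z \<in> Z" "h \<in> H" "x = z \<otimes> h"
      using subsetD[OF subset_trans[OF A_subset AH_ZH] x] by (auto simp: set_mult_def)
    have "h = inv z \<otimes> x" using z by simp
    then have hB: "h \<in> A \<inter> H" using ZA[OF z(1)] x z(2) by simp
    have "h \<in> Z"
    proof (rule ZI)
      fix n assume n: "n \<in> N"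
      show "n \<otimes> h \<otimes> inv n \<otimes> inv h \<in> A \<inter> H"
        by (rule B.m_closed[OF normB[OF subsetD[OF N(2) n] hB] B.m_inv_closed[OF hB]])
    qed (use hB in simp)
    then show ?thesis using z by simp
  qed
  have "derived G N \<subseteq> H"
    by (rule derived_subset_of_trivial_conj[OF N(1,2)]) (use ZD[OF AZ] in blast)
  then show thesis using that N(1,2,5) by blast
qed

end

section \<open>Induction on the derived length\<close>

context group
begin

text \<open>The derived length is measured at the base point alone, and \<open>H\<close> may contain
  normal subgroups. So the induction hypothesis covers two actions: \<Gamma> on the cosets of A H,
  and A H on the orbit of a class under the linear part. In both, A lies in the new
  stabilizer.\<close>

lemma subquadratic_virtually_derived:
  assumes "subgroup \<Gamma> G" "subgroup H G" "H \<subseteq> \<Gamma>" "finitely_generated G \<Gamma>"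
    and "(derived G ^^ d) \<Gamma> \<subseteq> H" "\<not> finite_index G \<Gamma> H" "subquadratic G \<Gamma> H"
  shows "\<exists>\<Lambda> H'. subgroup \<Lambda> G \<and> \<Lambda> \<subseteq> \<Gamma> \<and> finite_index G \<Gamma> \<Lambda> \<and>
    subgroup H' G \<and> H \<subseteq> H' \<and> \<not> finite_index G \<Gamma> H' \<and> derived G \<Lambda> \<subseteq> H'"
  using assms
proof (induction d arbitrary: \<Gamma> H)
  case 0
  have "x <# H = \<one> <# H" if "x \<in> \<Gamma>" for x
    using one_l_coset_eq_iff[OF 0(2)] subgroup.mem_carrier[OF 0(1)] subsetD[OF 0(5)] that by simp
  then have "(\<lambda>x. x <# H) ` \<Gamma> \<subseteq> {\<one> <# H}" by blast
  then have "finite_index G \<Gamma> H" unfolding finite_index_def by (rule finite_subset) simp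
  then show ?case using 0(6) by simp
next
  case (Suc d)
  define A where "A = (derived G ^^ d) \<Gamma>"
  interpret \<Gamma>: subgroup \<Gamma> G by (rule Suc.prems(1))
  have A: "subgroup A G" unfolding A_def by (rule exp_of_derived_is_subgroup[OF Suc.prems(1)])
  have normA: "normalizes G \<Gamma> A" unfolding A_def by (rule normalizes_exp_of_derived[OF Suc.prems(1)])
  have A\<Gamma>: "A \<subseteq> \<Gamma>"
  proof -
    have "(derived G ^^ n) \<Gamma> \<subseteq> \<Gamma>" for n
      by (induction n) (simp_all add: derived_incl[OF _ Suc.prems(1)])
    then show ?thesis by (simp add: A_def)
  qed
  interpret abelian_orbit G A H
    by (intro abelian_orbit.intro abelian_orbit_axioms.intro group_axioms A Suc.prems(2)
        normalizes_mono[OF normA Suc.prems(3)]) (use Suc.prems(5) in \<open>simp add: A_def\<close>)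
  have AH\<Gamma>: "A <#> H \<subseteq> \<Gamma>" using A\<Gamma> Suc.prems(3) by (auto simp: set_mult_def)
  show ?case
  proof (cases "finite_index G \<Gamma> (A <#> H)")
    case False
    have "\<exists>\<Lambda> H'. subgroup \<Lambda> G \<and> \<Lambda> \<subseteq> \<Gamma> \<and> finite_index G \<Gamma> \<Lambda> \<and>
      subgroup H' G \<and> A <#> H \<subseteq> H' \<and> \<not> finite_index G \<Gamma> H' \<and> derived G \<Lambda> \<subseteq> H'"
      by (rule Suc.IH[OF Suc.prems(1) subgroup_AH AH\<Gamma> Suc.prems(4) _ False
            subquadratic_mono[OF Suc.prems(7) H subgroup_AH H_subset Suc.prems(1)]])
        (use A_subset in \<open>simp add: A_def\<close>)
    then show ?thesis using subset_trans[OF H_subset] by blast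
  next
    case True
    have fg: "finitely_generated G (A <#> H)"
      by (rule finitely_generated_finite_index[OF Suc.prems(4) True subgroup_AH AH\<Gamma>])
    have AHc: "A <#> H \<subseteq> carrier G" by (rule subgroup.subset[OF subgroup_AH])
    have "finite_index G (A <#> H) (conj_stabilizer a)" if a: "a \<in> A" for a
    proof (rule ccontr)
      assume inf: "\<not> finite_index G (A <#> H) (conj_stabilizer a)"
      have "(derived G ^^ d) (A <#> H) \<subseteq> A" unfolding A_def using mono_exp_of_derived[OF AH\<Gamma>] by (simp add: A_def)
      then have der: "(derived G ^^ d) (A <#> H) \<subseteq> conj_stabilizer a"
        using A_subset_conj_stabilizer[OF a] by (rule subset_trans)
      have sub: "conj_stabilizer a \<subseteq> A <#> H" by (auto simp: conj_stabilizer_def)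
      obtain \<Lambda> H' where \<Lambda>: "subgroup \<Lambda> G" "\<Lambda> \<subseteq> A <#> H" "finite_index G (A <#> H) \<Lambda>"
        and H': "subgroup H' G" "conj_stabilizer a \<subseteq> H'" "\<not> finite_index G (A <#> H) H'"
          "derived G \<Lambda> \<subseteq> H'"
        using Suc.IH[OF subgroup_AH subgroup_conj_stabilizer[OF a] sub fg der inf
            subquadratic_conj_stabilizer[OF Suc.prems(1) A\<Gamma> Suc.prems(3,7) a]]
        by (elim exE conjE)
      have fg\<Lambda>: "finitely_generated G \<Lambda>" by (rule finitely_generated_finite_index[OF fg \<Lambda>(3,1,2)])
      \<comment> \<open>Every element of \<Lambda> has a power in the stabilizer of the class of a,
        hence in H'. So the finitely generated abelian quotient of \<Lambda> is finite, against the
        infinite index of H'.\<close>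
      have "finite_index G \<Lambda> H'"
      proof (rule finite_index_of_torsion[OF fg\<Lambda> H'(1,4)])
        fix t assume "t \<in> \<Lambda>"
        from conj_stabilizer_periodic[OF Suc.prems(1) A\<Gamma> Suc.prems(3,7) a subsetD[OF \<Lambda>(2) this]]
        show "\<exists>m>0. t [^] (m::nat) \<in> H'" using H'(2) by blast
      qed
      then show False using finite_index_trans[OF \<Lambda>(3) _ \<Lambda>(1) H'(1) AHc] H'(3) by blast
    qed
    from virtually_trivial_conj[OF fg this]
    obtain N where N: "subgroup N G" "N \<subseteq> A <#> H" "finite_index G (A <#> H) N" "derived G N \<subseteq> H"
      by blast
    have "finite_index G \<Gamma> N" by (rule finite_index_trans[OF True N(3) subgroup_AH N(1) \<Gamma>.subset])
    \<comment> \<open>Here \<open>H\<close> itself serves as H'.\<close>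
    then show ?thesis using N(1,4) subset_trans[OF N(2) AH\<Gamma>] Suc.prems(6) H by blast
  qed
qed

text \<open>If \<open>H\<close> has finite index, its normal core already acts trivially on G/H.
  Otherwise \<Lambda> is replaced by its normal core \<open>N\<close>, so that [N, N] is normal in
  G; it lies in a subgroup of infinite index above \<open>H\<close>, hence has infinitely many
  orbits on G/H, and \<open>subquadratic_torsion\<close> applies.\<close>

lemma subquadratic_virtually_torsion_derived:
  assumes "finitely_generated G (carrier G)" "solvable G" "subgroup H G" "subquadratic G (carrier G) H"
  shows "\<exists>N. subgroup N G \<and> finite_index G (carrier G) N \<and>
    (\<forall>a\<in>derived G N. \<exists>m>0. \<forall>g\<in>carrier G. inv g \<otimes> a [^] (m::nat) \<otimes> g \<in> H)"
proof (cases "finite_index G (carrier G) H")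
  case True
  obtain N where N: "subgroup N G" "N \<subseteq> H" "normalizes G (carrier G) N" "finite_index G (carrier G) N"
    using finite_index_core[OF True subgroup_self assms(3)] by blast
  have "inv g \<otimes> a [^] (1::nat) \<otimes> g \<in> H" if "a \<in> derived G N" "g \<in> carrier G" for a g
  proof -
    have aN: "a \<in> N" by (rule subsetD[OF derived_incl[OF subset_refl N(1)] that(1)])
    have "inv g \<otimes> a \<otimes> g \<in> H"
      by (rule subsetD[OF N(2) normalizes_inv[OF N(3) subgroup_self that(2) aN]])
    then show ?thesis using subgroup.mem_carrier[OF N(1) aN] by simp
  qed
  then show ?thesis using N(1,4) zero_less_one by blast
next
  case False
  obtain n where "(derived G ^^ n) (carrier G) = {\<one>}"
    using assms(2) solvable_iff_trivial_derived_seq by blast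
  then have "(derived G ^^ n) (carrier G) \<subseteq> H" using subgroup.one_closed[OF assms(3)] by simp
  from subquadratic_virtually_derived[OF subgroup_self assms(3) subgroup.subset[OF assms(3)] assms(1) this False assms(4)]
  obtain \<Lambda> H' where \<Lambda>: "subgroup \<Lambda> G" "finite_index G (carrier G) \<Lambda>" "subgroup H' G" "H \<subseteq> H'"
    "\<not> finite_index G (carrier G) H'" "derived G \<Lambda> \<subseteq> H'"
    by (elim exE conjE)
  obtain N where N: "subgroup N G" "N \<subseteq> \<Lambda>" "normalizes G (carrier G) N" "finite_index G (carrier G) N"
    using finite_index_core[OF \<Lambda>(2) subgroup_self \<Lambda>(1)] by blast
  have Nc: "N \<subseteq> carrier G" by (rule subgroup.subset[OF N(1)])
  have "\<exists>m>0. \<forall>g\<in>carrier G. inv g \<otimes> a [^] (m::nat) \<otimes> g \<in> H" if "a \<in> derived G N" for a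
    by (rule subquadratic_torsion[OF assms(1) derived_is_subgroup[OF Nc] assms(3) \<Lambda>(3)
          normalizes_derived[OF subgroup_self Nc N(3)] derived_in_carrier[OF Nc]
          subset_trans[OF mono_derived[OF N(2)] \<Lambda>(6)] \<Lambda>(4,5) assms(4) that])
  then show ?thesis using N(1,4) by blast
qed

section \<open>From word balls and orbits to cosets of stabilizers\<close>

lemma word_length_le:
  assumes "set ws \<subseteq> S"
  shows "word_length G S (foldr (mult G) ws \<one>) \<le> length ws"
  unfolding word_length_def by (rule Least_le) (use assms in blast)

lemma word_ball_mult:
  assumes S: "symmetric_generating_set G S" and g: "g \<in> word_ball G S m" and h: "h \<in> word_ball G S n"
  shows "g \<otimes> h \<in> word_ball G S (m + n)"
proof -
  have S': "S \<subseteq> carrier G" using S by (simp add: symmetric_generating_set_def)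
  obtain us where us: "set us \<subseteq> S" "length us = word_length G S g" "foldr (mult G) us \<one> = g"
    using word_length_witness[OF S, of g] g by (auto simp: word_ball_def)
  obtain vs where vs: "set vs \<subseteq> S" "length vs = word_length G S h" "foldr (mult G) vs \<one> = h"
    using word_length_witness[OF S, of h] h by (auto simp: word_ball_def)
  have "foldr (mult G) (us @ vs) \<one> = g \<otimes> h"
    using foldr_mult_append[OF subset_trans[OF us(1) S'] subset_trans[OF vs(1) S']] us(3) vs(3) by simp
  then have "word_length G S (g \<otimes> h) \<le> length (us @ vs)"
    using word_length_le[of "us @ vs" S] us(1) vs(1) by simp
  then show ?thesis using us(2) vs(2) g h by (simp add: word_ball_def)
qed

lemma set_power_subset_word_ball:
  assumes S: "symmetric_generating_set G S" and F: "F \<subseteq> word_ball G S m"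
  shows "set_power G F n \<subseteq> word_ball G S (m * n)"
proof (induction n)
  case 0
  have "word_length G S \<one> = 0" using word_length_le[of "[]" S] by simp
  then show ?case by (simp add: word_ball_def)
next
  case (Suc n)
  show ?case
  proof
    fix x assume "x \<in> set_power G F (Suc n)"
    then obtain s y where "s \<in> F" "y \<in> set_power G F n" "x = s \<otimes> y" by (auto simp: set_mult_def)
    then show "x \<in> word_ball G S (m * Suc n)"
      using word_ball_mult[OF S subsetD[OF F] subsetD[OF Suc]] by simp
  qed
qed

end

lemma (in group_action) subquadratic_stabilizer:
  assumes S: "finite S" "symmetric_generating_set G S" and x: "x \<in> E"
    and growth: "\<not> (\<lambda>n. real n ^ 2) \<preceq> (\<lambda>n. real (action_growth G S E \<phi> n))"
  shows "subquadratic G (carrier G) (stabilizer G \<phi> x)"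
  unfolding subquadratic_def
proof (intro allI impI)
  interpret group G using group_hom group_hom.axioms(1) by auto
  fix F C assume F: "finite F" "F \<subseteq> carrier G"
  define m where "m = Max (insert 0 (word_length G S ` F))"
  have Fm: "F \<subseteq> word_ball G S m"
    using F by (auto simp: word_ball_def m_def)
  \<comment> \<open>C' serves both as the factor, where it must be at least \<open>C\<close>, and as
    the dilation of the radius, where it must be at least the word length \<open>m\<close> of the
    letters in \<open>F\<close>.\<close>
  define C' where "C' = C + m + 1"
  have "\<exists>n\<ge>C. \<not> real n ^ 2 \<le> real C' * real (action_growth G S E \<phi> (C' * n))"
    using growth unfolding growth_le_def eventually_sequentially C'_def
    by (metis add_gr_0 zero_less_one)
  then obtain n where n: "n \<ge> C" "\<not> real n ^ 2 \<le> real C' * real (action_growth G S E \<phi> (C' * n))"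
    by blast
  then have "real (C' * action_growth G S E \<phi> (C' * n)) < real (n * n)"
    by (simp add: power2_eq_square)
  then have n2: "C' * action_growth G S E \<phi> (C' * n) < n * n" by (simp only: of_nat_less_iff)
  have "C * card ((\<lambda>y. (y \<otimes> g) <# stabilizer G \<phi> x) ` set_power G F n) \<le> n * n"
    if g: "g \<in> carrier G" for g
  proof -
    \<comment> \<open>The coset of y g modulo the stabilizer of x corresponds to the point y z.
      Growth is a maximum over all points, so the bound is uniform in g.\<close>
    define z where "z = \<phi> g x"
    have z: "z \<in> E" unfolding z_def using element_image[OF g x] by simp
    have P: "set_power G F n \<subseteq> word_ball G S (C' * n)"
    proof
      fix y assume "y \<in> set_power G F n"
      then have "y \<in> carrier G" "word_length G S y \<le> m * n"
        using set_power_subset_word_ball[OF S(2) Fm, of n] by (auto simp: word_ball_def)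
      moreover have "m * n \<le> C' * n" by (intro mult_le_mono1) (simp add: C'_def)
      ultimately show "y \<in> word_ball G S (C' * n)"
        unfolding word_ball_def using le_trans by blast
    qed
    have "card ((\<lambda>y. (y \<otimes> g) <# stabilizer G \<phi> x) ` set_power G F n)
        \<le> card ((\<lambda>y. \<phi> y z) ` set_power G F n)"
    proof (rule card_image_factor)
      fix y y' assume y: "y \<in> set_power G F n" "y' \<in> set_power G F n" and e: "\<phi> y z = \<phi> y' z"
      have yc: "y \<in> carrier G" "y' \<in> carrier G"
        using y subsetD[OF set_power_subset[OF subgroup_self F(2)]] by simp_all
      have "\<phi> (inv (y \<otimes> g) \<otimes> (y' \<otimes> g)) x = \<phi> (inv (y \<otimes> g)) (\<phi> (y' \<otimes> g) x)"
        using yc g x by (intro composition_rule) simp_all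
      also have "\<phi> (y' \<otimes> g) x = \<phi> (y \<otimes> g) x"
        using composition_rule[OF x yc(1) g] composition_rule[OF x yc(2) g] e by (simp add: z_def)
      also have "\<phi> (inv (y \<otimes> g)) (\<phi> (y \<otimes> g) x) = x"
        using orbit_sym_aux[OF _ x refl] yc g by simp
      finally have "inv (y \<otimes> g) \<otimes> (y' \<otimes> g) \<in> stabilizer G \<phi> x"
        using yc g by (simp add: stabilizer_def)
      then show "(y \<otimes> g) <# stabilizer G \<phi> x = (y' \<otimes> g) <# stabilizer G \<phi> x"
        using l_coset_eq_iff[OF stabilizer_subgroup[OF x], of "y \<otimes> g" "y' \<otimes> g"] yc g by simp
    qed (rule finite_imageI[OF finite_set_power[OF F(1)]])
    also have "\<dots> \<le> card ((\<lambda>y. \<phi> y z) ` word_ball G S (C' * n))"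
      by (intro card_mono finite_imageI finite_word_ball[OF S(2,1)] image_mono P)
    also have "\<dots> \<le> action_growth G S E \<phi> (C' * n)"
      unfolding action_growth_def
      by (rule Max_ge[OF finite_action_growth_set[OF S(2,1)] imageI[OF z]])
    finally have "C * card ((\<lambda>y. (y \<otimes> g) <# stabilizer G \<phi> x) ` set_power G F n)
        \<le> C' * action_growth G S E \<phi> (C' * n)"
      by (intro mult_le_mono) (simp add: C'_def)
    then show ?thesis using n2 by linarith
  qed
  then show "\<exists>n\<ge>C. \<forall>g\<in>carrier G.
      C * card ((\<lambda>y. (y \<otimes> g) <# stabilizer G \<phi> x) ` set_power G F n) \<le> n * n"
    using n(1) by blast
qed

context group
begin

text \<open>Inversion exchanges left and right cosets.\<close>

lemma finite_rcosets_iff_finite_index: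
  assumes "subgroup H G"
  shows "finite (rcosets H) \<longleftrightarrow> finite_index G (carrier G) H"
proof -
  have r: "H #> x = H #> y \<longleftrightarrow> x \<otimes> inv y \<in> H" if "x \<in> carrier G" "y \<in> carrier G" for x y
    using that assms repr_independence[of x H y] rcos_self[OF that(1) assms] subgroup.rcos_module[OF assms is_group that(2,1)]
    by metis
  have R: "rcosets H = (\<lambda>x. H #> x) ` carrier G" by (auto simp: RCOSETS_def)
  have inv_img: "m_inv G ` carrier G = carrier G"
    by (metis (no_types, lifting) image_cong inv_closed inv_inv image_subsetI subset_antisym subsetI image_eqI)
  have "finite (rcosets H)" if "finite_index G (carrier G) H"
  proof -
    have "finite ((\<lambda>x. H #> inv x) ` carrier G)"
    proof (rule finite_image_factor)
      show "H #> inv x = H #> inv y" if "x \<in> carrier G" "y \<in> carrier G" "x <# H = y <# H" for x y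
        using that r[of "inv x" "inv y"] l_coset_eq_iff[OF assms, of x y] by simp
    qed (use that in \<open>simp add: finite_index_def\<close>)
    moreover have "(\<lambda>x. H #> inv x) ` carrier G = (\<lambda>x. H #> x) ` m_inv G ` carrier G"
      by (simp only: image_image)
    ultimately show ?thesis unfolding R inv_img by simp
  qed
  moreover have "finite_index G (carrier G) H" if "finite (rcosets H)"
  proof -
    have "finite ((\<lambda>x. inv x <# H) ` carrier G)"
    proof (rule finite_image_factor)
      show "inv x <# H = inv y <# H" if "x \<in> carrier G" "y \<in> carrier G" "H #> x = H #> y" for x y
        using that r[of x y] l_coset_eq_iff[OF assms, of "inv x" "inv y"] by simp
    qed (use that R in simp)
    moreover have "(\<lambda>x. inv x <# H) ` carrier G = (\<lambda>x. x <# H) ` m_inv G ` carrier G"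
      by (simp only: image_image)
    ultimately show ?thesis unfolding finite_index_def inv_img by simp
  qed
  ultimately show ?thesis by blast
qed

end

section \<open>Faithful actions with finitely many orbits\<close>

lemma (in faithful_action) quadratic_growth:
  assumes "finite S" "symmetric_generating_set G S" "solvable G" "virtually torsion_free G"
    and "\<not> virtually comm_group G" and "finite (orbits G E \<phi>)"
  shows "(\<lambda>n. real n ^ 2) \<preceq> (\<lambda>n. real (action_growth G S E \<phi> n))"
proof (rule ccontr)
  assume growth: "\<not> ?thesis"
  interpret group G using group_hom group_hom.axioms(1) by auto
  have fg: "finitely_generated G (carrier G)"
    using assms(1,2) unfolding finitely_generated_def symmetric_generating_set_def by metis
  obtain T where T: "subgroup T G" "finite_index G (carrier G) T" "torsion_free (G\<lparr>carrier := T\<rparr>)"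
    using assms(4) finite_rcosets_iff_finite_index unfolding virtually_def by blast
  have "\<exists>N. subgroup N G \<and> finite_index G (carrier G) N \<and>
      (\<forall>a\<in>derived G N. \<exists>m>0. \<forall>y\<in>B. \<phi> (a [^] (m::nat)) y = y)" if B: "B \<in> orbits G E \<phi>" for B
  proof -
    obtain x where x: "x \<in> E" "B = orbit G \<phi> x" using B by (auto simp: orbits_def)
    obtain N where N: "subgroup N G" "finite_index G (carrier G) N"
      "\<And>a. a \<in> derived G N \<Longrightarrow>
        \<exists>m>0. \<forall>g\<in>carrier G. inv g \<otimes> a [^] (m::nat) \<otimes> g \<in> stabilizer G \<phi> x"
      using subquadratic_virtually_torsion_derived[OF fg assms(3) stabilizer_subgroup[OF x(1)]
          subquadratic_stabilizer[OF assms(1,2) x(1) growth]] by blast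
    have "\<exists>m>0. \<forall>y\<in>B. \<phi> (a [^] (m::nat)) y = y" if a: "a \<in> derived G N" for a
    proof -
      have aG: "a \<in> carrier G"
        using a derived_in_carrier[OF subgroup.subset[OF N(1)]] by blast
      obtain m :: nat where m: "m > 0"
        "\<And>g. g \<in> carrier G \<Longrightarrow> inv g \<otimes> a [^] m \<otimes> g \<in> stabilizer G \<phi> x"
        using N(3)[OF a] by blast
      have "\<phi> (a [^] m) y = y" if y: "y \<in> B" for y
      proof -
        obtain g where g: "g \<in> carrier G" "y = \<phi> g x" using y x(2) by (auto simp: orbit_def)
        define k where "k = inv g \<otimes> a [^] m \<otimes> g"
        have k: "k \<in> carrier G" "\<phi> k x = x" using m(2)[OF g(1)] by (auto simp: stabilizer_def k_def)
        have "\<phi> (a [^] m) y = \<phi> (a [^] m \<otimes> g) x"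
          using composition_rule[OF x(1) _ g(1)] aG by (simp add: g(2))
        also have "a [^] m \<otimes> g = g \<otimes> k" using g(1) aG by (simp add: k_def m_assoc)
        also have "\<phi> (g \<otimes> k) x = y" using composition_rule[OF x(1) g(1) k(1)] k(2) g(2) by simp
        finally show ?thesis .
      qed
      then show ?thesis using m(1) by blast
    qed
    then show ?thesis using N(1,2) by blast
  qed
  then obtain N where N: "\<And>B. B \<in> orbits G E \<phi> \<Longrightarrow> subgroup (N B) G \<and> finite_index G (carrier G) (N B)"
    "\<And>B a. B \<in> orbits G E \<phi> \<Longrightarrow> a \<in> derived G (N B) \<Longrightarrow> \<exists>m>0. \<forall>y\<in>B. \<phi> (a [^] (m::nat)) y = y"
    by metis
  define \<Lambda> where "\<Lambda> = T \<inter> (carrier G \<inter> (\<Inter>B\<in>orbits G E \<phi>. N B))"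
  note INT = finite_index_INT[OF subgroup_self assms(6) N(1)]
  have \<Lambda>: "subgroup \<Lambda> G" "finite_index G (carrier G) \<Lambda>"
    unfolding \<Lambda>_def using INT
    by (auto intro!: subgroups_Inter_pair[OF T(1)] finite_index_Int[OF T(2) _ T(1)])
  interpret \<Lambda>: subgroup \<Lambda> G by (rule \<Lambda>(1))
  have trivial: "a = \<one>" if a: "a \<in> derived G \<Lambda>" for a
  proof -
    have "derived G \<Lambda> \<subseteq> \<Lambda>" by (rule derived_incl[OF subset_refl \<Lambda>(1)])
    then have aT: "a \<in> T" and aG: "a \<in> carrier G" using a by (auto simp: \<Lambda>_def)
    have "\<exists>m>0. \<forall>y\<in>B. \<phi> (a [^] (m::nat)) y = y" if B: "B \<in> orbits G E \<phi>" for B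
    proof -
      have "\<Lambda> \<subseteq> N B" using B by (auto simp: \<Lambda>_def)
      from N(2)[OF B subsetD[OF mono_derived[OF this] a]] show ?thesis .
    qed
    then obtain m where m: "\<And>B. B \<in> orbits G E \<phi> \<Longrightarrow> m B > 0"
      "\<And>B y. B \<in> orbits G E \<phi> \<Longrightarrow> y \<in> B \<Longrightarrow> \<phi> (a [^] (m B :: nat)) y = y"
      by metis
    \<comment> \<open>The exponent depends on the orbit; as there are finitely many orbits, the
      product is a common multiple.\<close>
    define M where "M = (\<Prod>B\<in>orbits G E \<phi>. m B)"
    have "M > 0" unfolding M_def using m(1) by (intro prod_pos) blast
    have "\<phi> (a [^] M) y = y" if y: "y \<in> E" for y
    proof -
      define B where "B = orbit G \<phi> y"
      have B: "B \<in> orbits G E \<phi>" "y \<in> B" using y orbit_refl[OF y] by (auto simp: B_def orbits_def)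
      have "m B dvd M" unfolding M_def using assms(6) B(1) by (rule dvd_prodI)
      then obtain k where k: "M = m B * k" by blast
      have "\<phi> ((a [^] m B) [^] k) y = y"
      proof (induction k)
        case 0
        show ?case using id_eq_one[symmetric] y by simp
      next
        case (Suc k)
        then show ?case using composition_rule[OF y, of "(a [^] m B) [^] k" "a [^] m B"] m(2)[OF B] aG by simp
      qed
      then show ?thesis using aG by (simp add: k nat_pow_pow)
    qed
    \<comment> \<open>The values of \<phi> are extensional functions on E, so agreement on E is
      equality, to which faithfulness applies.\<close>
    then have "\<phi> (a [^] M) = \<phi> \<one>"
      using bij_prop0[of "a [^] M"] aG unfolding id_eq_one[symmetric] Bij_def
      by (intro extensionalityI[of _ E]) auto
    then have "a [^] M = \<one>" using faithful aG by (simp add: inj_on_eq_iff)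
    then have "a [^]\<^bsub>G\<lparr>carrier := T\<rparr>\<^esub> M = \<one>\<^bsub>G\<lparr>carrier := T\<rparr>\<^esub>" using nat_pow_consistent[of a M T] by simp
    then have "a = \<one>\<^bsub>G\<lparr>carrier := T\<rparr>\<^esub>" using T(3) aT \<open>M > 0\<close> unfolding torsion_free_def by simp
    then show ?thesis by simp
  qed
  have "comm_group (G\<lparr>carrier := \<Lambda>\<rparr>)"
  proof (rule group.group_comm_groupI[OF subgroup_imp_group[OF \<Lambda>(1)]], simp)
    fix x y assume xy: "x \<in> \<Lambda>" "y \<in> \<Lambda>"
    have "x \<otimes> y \<otimes> inv x \<otimes> inv y = \<one>" by (rule trivial[OF commutator_mem_derived[OF xy]])
    then have "x \<otimes> y \<otimes> inv x \<otimes> inv y \<otimes> (y \<otimes> x) = \<one> \<otimes> (y \<otimes> x)" by simp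
    then show "x \<otimes> y = y \<otimes> x"
      using \<Lambda>.mem_carrier[OF xy(1)] \<Lambda>.mem_carrier[OF xy(2)] by (simp add: m_assoc)
  qed
  then show False
    using assms(5) \<Lambda> finite_rcosets_iff_finite_index[OF \<Lambda>(1)] unfolding virtually_def by blast
qed

theorem theorem7p14:
  fixes G :: "('a, 'b) monoid_scheme"
    and S :: "'a set"
    and X :: "'x set"
    and \<phi> :: "'a \<Rightarrow> 'x \<Rightarrow> 'x"
  assumes "group G"
    and "finite S" and "symmetric_generating_set G S"
    and "solvable G"
    and "virtually torsion_free G"
    and "\<not> virtually comm_group G"
    and "X \<noteq> {}" and "faithful_action G X \<phi>"
    and "finite (orbits G X \<phi>)"
  shows "(\<lambda>n. real n ^ 2) \<preceq> (\<lambda>n. real (action_growth G S X \<phi> n))"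
  by (rule faithful_action.quadratic_growth[OF assms(8,2-6,9)])

end
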